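(* Let $P_k$ be the (unlabeled) path with $k$ edges and let $e$ be the (unlabeled) graph consisting of a single edge. For any $\lambda\in\mathbb{R}$ and any odd integer $k\ge 3$, there is no sum of squares (sos) $g\in\mathcal{A}_\emptyset$ such that $(\lambda P_k-e^k)(1+g)$ is a sum of squares (sos).
   Context: All graphs are finite and simple (no loops or multiple edges). A graph is partially labeled if some subset of its vertices (possibly empty, possibly all) carries pairwise distinct labels from $\mathbb{N}=\{1,2,3,\dots\}$, each vertex having at most one label; it is unlabeled if no vertex is labeled. Partially labeled graphs are identified up to label-preserving isomorphism. $\mathcal{A}$ is the real vector space of formal finite $\mathbb{R}$-linear combinations ("graph combinations") of partially labeled graphs without isolated vertices, including the empty graph, denoted $1$. The product $H_1H_2$ of two partially labeled graphs is obtained by taking the disjoint union, identifying vertices carrying the same label, and keeping only one copy of any doubled edge; extended bilinearly, this makes $\mathcal{A}$ a commutative $\mathbb{R}$-algebra with identity $1$. $\mathcal{A}_\emptyset$ is the subalgebra spanned by unlabeled graphs, where the product is disjoint union (so $e^k$ is the disjoint union of $k$ edges). The linear map $[[\cdot]]:\mathcal{A}\to\mathcal{A}_\emptyset$ removes all labels. A sum of squares (sos) is an element of $\mathcal{A}_\emptyset$ of the form $\sum_i[[a_i^2]]$, a finite sum with $a_i\in\mathcal{A}$. *)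

theory Defs
  imports "HOL-Analysis.Finite_Function_Topology" "HOL-Library.Nat_Bijection"
begin

section \<open>Partially labeled graphs\<close>

(* Concrete representatives: finite simple graphs with vertices in nat, edges given as
   two-element vertex sets, and a partial labeling of the vertices. *)

datatype pregraph =
  Pregraph (verts: "nat set") (edges: "nat set set") (lab: "nat \<rightharpoonup> nat")

(* "verts G \<subseteq> \<Union> (edges G)" says that there are no isolated vertices, labeled or not.
   The labels are the positive integers. *)

definition wf_pregraph :: "pregraph \<Rightarrow> bool" where
  "wf_pregraph G \<longleftrightarrow>
     finite (verts G) \<and>
     edges G \<subseteq> {{u, v} | u v. u \<in> verts G \<and> v \<in> verts G \<and> u \<noteq> v} \<and>
     verts G \<subseteq> \<Union> (edges G) \<and>
     dom (lab G) \<subseteq> verts G \<and>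
     inj_on (lab G) (dom (lab G)) \<and>
     0 \<notin> ran (lab G)"

definition iso_pregraph :: "pregraph \<Rightarrow> pregraph \<Rightarrow> bool" where
  "iso_pregraph G H \<longleftrightarrow> wf_pregraph G \<and> wf_pregraph H \<and>
     (\<exists>f. bij_betw f (verts G) (verts H) \<and> (`) f ` edges G = edges H \<and>
          (\<forall>v\<in>verts G. lab H (f v) = lab G v))"

definition empty_pregraph :: pregraph where
  "empty_pregraph = Pregraph {} {} Map.empty"

(* Vertex names for gluing: a vertex labeled n becomes (0, n), an unlabeled vertex v of the
   i-th factor (i > 0) becomes (i, v); pairs are encoded in nat. Hence taking the union of the
   renamed factors identifies exactly the vertices carrying the same label. *)

definition glue_vertex :: "nat \<Rightarrow> pregraph \<Rightarrow> nat \<Rightarrow> nat" where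
  "glue_vertex i G v =
     (case lab G v of Some n \<Rightarrow> prod_encode (0, n) | None \<Rightarrow> prod_encode (i, v))"

definition glue_pregraph :: "pregraph \<Rightarrow> pregraph \<Rightarrow> pregraph" where
  "glue_pregraph G H = Pregraph
     (glue_vertex 1 G ` verts G \<union> glue_vertex 2 H ` verts H)
     ((`) (glue_vertex 1 G) ` edges G \<union> (`) (glue_vertex 2 H) ` edges H)
     (\<lambda>w. case prod_decode w of (i, n) \<Rightarrow>
        if i = 0 \<and> n \<in> ran (lab G) \<union> ran (lab H) then Some n else None)"

definition unlabel_pregraph :: "pregraph \<Rightarrow> pregraph" where
  "unlabel_pregraph G = Pregraph (verts G) (edges G) Map.empty"

(* The path with k edges. For k = 0 the single vertex would be isolated; it is left out. *)

definition path_pregraph :: "nat \<Rightarrow> pregraph" where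
  "path_pregraph k = Pregraph (if k = 0 then {} else {..k}) {{i, Suc i} | i. i < k} Map.empty"

definition edge_pregraph :: pregraph where
  "edge_pregraph = Pregraph {0, 1} {{0, 1}} Map.empty"


subsection \<open>Uniqueness of gluings up to isomorphism\<close>

definition gluing ::
    "nat set \<Rightarrow> (nat \<Rightarrow> pregraph) \<Rightarrow> (nat \<Rightarrow> nat \<Rightarrow> nat) \<Rightarrow> pregraph \<Rightarrow> bool" where
  "gluing I F f K \<longleftrightarrow> wf_pregraph K \<and> (\<forall>i\<in>I. wf_pregraph (F i)) \<and>
     verts K = (\<Union>i\<in>I. f i ` verts (F i)) \<and>
     edges K = (\<Union>i\<in>I. (`) (f i) ` edges (F i)) \<and>
     (\<forall>i\<in>I. \<forall>v\<in>verts (F i). lab K (f i v) = lab (F i) v) \<and>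
     (\<forall>i\<in>I. \<forall>j\<in>I. \<forall>v\<in>verts (F i). \<forall>w\<in>verts (F j).
        f i v = f j w \<longrightarrow> (i = j \<and> v = w) \<or> lab (F i) v \<noteq> None)"

lemma wf_pregraph_edgeD: "wf_pregraph G \<Longrightarrow> e \<in> edges G \<Longrightarrow> e \<subseteq> verts G"
  unfolding wf_pregraph_def by blast

lemma wf_lab_inj:
  "wf_pregraph G \<Longrightarrow> lab G v = Some n \<Longrightarrow> lab G w = Some n \<Longrightarrow> v = w"
  unfolding wf_pregraph_def by (metis domI inj_onD)

lemma gluing_eq_iff:
  assumes "gluing I F f K" "i \<in> I" "j \<in> I" "v \<in> verts (F i)" "w \<in> verts (F j)"
  shows "f i v = f j w \<longleftrightarrow>
    (i = j \<and> v = w) \<or> (\<exists>n. lab (F i) v = Some n \<and> lab (F j) w = Some n)"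
proof -
  have wf: "wf_pregraph K"
    and l: "lab K (f i v) = lab (F i) v" "lab K (f j w) = lab (F j) w"
    and e: "f i v = f j w \<longrightarrow> (i = j \<and> v = w) \<or> lab (F i) v \<noteq> None"
    using assms unfolding gluing_def by blast+
  show ?thesis
    using l e wf_lab_inj[OF wf, of "f i v" _ "f j w"] by (metis not_None_eq)
qed

lemma gluing_unique:
  assumes g: "gluing I F f K" and g': "gluing I F f' K'"
  shows "iso_pregraph K K'"
proof -
  have wf: "wf_pregraph K" "wf_pregraph K'" "\<And>i. i \<in> I \<Longrightarrow> wf_pregraph (F i)"
    using g g' unfolding gluing_def by auto
  have V: "verts K = (\<Union>i\<in>I. f i ` verts (F i))" "verts K' = (\<Union>i\<in>I. f' i ` verts (F i))"
    and E: "edges K = (\<Union>i\<in>I. (`) (f i) ` edges (F i))"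
           "edges K' = (\<Union>i\<in>I. (`) (f' i) ` edges (F i))"
    using g g' unfolding gluing_def by auto
  have L: "lab K (f i v) = lab (F i) v" "lab K' (f' i v) = lab (F i) v"
    if "i \<in> I" "v \<in> verts (F i)" for i v
    using g g' that unfolding gluing_def by auto
  have eq: "f i v = f j w \<longleftrightarrow> f' i v = f' j w"
    if "i \<in> I" "j \<in> I" "v \<in> verts (F i)" "w \<in> verts (F j)" for i j v w
    using gluing_eq_iff[OF g that] gluing_eq_iff[OF g' that] by simp
  define h where "h x = (THE y. \<exists>i\<in>I. \<exists>v\<in>verts (F i). x = f i v \<and> y = f' i v)" for x
  have h: "h (f i v) = f' i v" if "i \<in> I" "v \<in> verts (F i)" for i v
    unfolding h_def
  proof (rule the_equality)
    show "\<exists>j\<in>I. \<exists>w\<in>verts (F j). f i v = f j w \<and> f' i v = f' j w"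
      using that by blast
  next
    fix y assume "\<exists>j\<in>I. \<exists>w\<in>verts (F j). f i v = f j w \<and> y = f' j w"
    then obtain j w where "j \<in> I" "w \<in> verts (F j)" "f i v = f j w" "y = f' j w" by blast
    with eq[OF that(1) this(1) that(2) this(2)] show "y = f' i v" by simp
  qed
  have "inj_on h (verts K)"
    by (rule inj_onI) (auto simp: V h eq)
  moreover have "h ` verts K = verts K'"
    unfolding V image_UN image_image using h by (intro SUP_cong refl image_cong) auto
  ultimately have "bij_betw h (verts K) (verts K')"
    by (simp add: bij_betw_def)
  moreover have "(`) h ` edges K = edges K'"
    unfolding E image_UN image_image
  proof (rule SUP_cong[OF refl], rule image_cong[OF refl])
    fix i e assume "i \<in> I" "e \<in> edges (F i)"
    then show "(\<lambda>x. h (f i x)) ` e = f' i ` e"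
      using h wf_pregraph_edgeD[OF wf(3)] by (intro image_cong refl) blast
  qed
  moreover have "\<forall>x\<in>verts K. lab K' (h x) = lab K x"
    by (auto simp: V h L)
  ultimately show ?thesis
    unfolding iso_pregraph_def using wf by blast
qed

lemma iso_pregraph_refl: "wf_pregraph G \<Longrightarrow> iso_pregraph G G"
  unfolding iso_pregraph_def by (auto intro!: exI[of _ id])

lemma iso_pregraph_sym:
  assumes "iso_pregraph G H" shows "iso_pregraph H G"
proof -
  obtain f where wf: "wf_pregraph G" "wf_pregraph H" and b: "bij_betw f (verts G) (verts H)"
    and E: "(`) f ` edges G = edges H" and L: "\<forall>v\<in>verts G. lab H (f v) = lab G v"
    using assms unfolding iso_pregraph_def by blast
  define g where "g = the_inv_into (verts G) f"
  have g: "g (f v) = v" if "v \<in> verts G" for v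
    using b that by (simp add: g_def bij_betw_def the_inv_into_f_f)
  have "g ` f ` e = e" if "e \<in> edges G" for e
    using wf_pregraph_edgeD[OF wf(1) that] g by (force simp: image_image)
  then have "(`) g ` edges H = edges G"
    unfolding E[symmetric] image_image by (simp add: image_image)
  moreover have "bij_betw g (verts H) (verts G)"
    unfolding g_def by (rule bij_betw_the_inv_into[OF b])
  moreover have "\<forall>w\<in>verts H. lab G (g w) = lab H w"
    using b L g unfolding bij_betw_def by (metis imageE)
  ultimately show ?thesis unfolding iso_pregraph_def using wf by blast
qed

lemma iso_pregraph_trans:
  assumes "iso_pregraph G H" "iso_pregraph H K" shows "iso_pregraph G K"
proof -
  obtain f where f: "bij_betw f (verts G) (verts H)"
    "(`) f ` edges G = edges H" "\<forall>v\<in>verts G. lab H (f v) = lab G v"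
    using assms(1) unfolding iso_pregraph_def by blast
  obtain g where g: "bij_betw g (verts H) (verts K)"
    "(`) g ` edges H = edges K" "\<forall>v\<in>verts H. lab K (g v) = lab H v"
    using assms(2) unfolding iso_pregraph_def by blast
  have "bij_betw (g \<circ> f) (verts G) (verts K)"
    using f(1) g(1) by (rule bij_betw_trans)
  moreover have "(`) (g \<circ> f) ` edges G = edges K"
    unfolding g(2)[symmetric] f(2)[symmetric] by (simp add: image_image)
  moreover have "\<forall>v\<in>verts G. lab K ((g \<circ> f) v) = lab G v"
    using f(3) g(3) bij_betw_apply[OF f(1)] by simp
  moreover have "wf_pregraph G" "wf_pregraph K"
    using assms by (simp_all add: iso_pregraph_def)
  ultimately show ?thesis unfolding iso_pregraph_def by blast
qed

lemma gluing_iso: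
  assumes g: "gluing I F f K" and iso: "\<And>i. i \<in> I \<Longrightarrow> iso_pregraph (G i) (F i)"
  shows "\<exists>f'. gluing I G f' K"
proof -
  have "\<forall>i\<in>I. \<exists>h. bij_betw h (verts (G i)) (verts (F i)) \<and> (`) h ` edges (G i) = edges (F i) \<and>
          (\<forall>v\<in>verts (G i). lab (F i) (h v) = lab (G i) v)"
    using iso unfolding iso_pregraph_def by blast
  then obtain h where b: "\<And>i. i \<in> I \<Longrightarrow> bij_betw (h i) (verts (G i)) (verts (F i))"
    and E: "\<And>i. i \<in> I \<Longrightarrow> (`) (h i) ` edges (G i) = edges (F i)"
    and L: "\<And>i v. i \<in> I \<Longrightarrow> v \<in> verts (G i) \<Longrightarrow> lab (F i) (h i v) = lab (G i) v"
    by metis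
  have V: "h i ` verts (G i) = verts (F i)" and inj: "inj_on (h i) (verts (G i))"
    if "i \<in> I" for i
    using b[OF that] by (auto simp: bij_betw_def)
  have hV: "h i v \<in> verts (F i)" if "i \<in> I" "v \<in> verts (G i)" for i v
    using V that by blast
  have wf: "wf_pregraph K" "\<And>i. i \<in> I \<Longrightarrow> wf_pregraph (G i)"
    using g iso unfolding gluing_def iso_pregraph_def by auto
  have VK: "verts K = (\<Union>i\<in>I. f i ` verts (F i))"
    and EK: "edges K = (\<Union>i\<in>I. (`) (f i) ` edges (F i))"
    and LK: "\<And>i v. i \<in> I \<Longrightarrow> v \<in> verts (F i) \<Longrightarrow> lab K (f i v) = lab (F i) v"
    using g unfolding gluing_def by auto
  have "gluing I G (\<lambda>i. f i \<circ> h i) K"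
    unfolding gluing_def
  proof (intro conjI ballI impI)
    show "verts K = (\<Union>i\<in>I. (f i \<circ> h i) ` verts (G i))"
      unfolding VK by (intro SUP_cong refl) (simp add: V[symmetric] image_image)
    show "edges K = (\<Union>i\<in>I. (`) (f i \<circ> h i) ` edges (G i))"
      unfolding EK by (intro SUP_cong refl) (simp add: E[symmetric] image_image)
  next
    fix i v assume "i \<in> I" "v \<in> verts (G i)"
    then show "lab K ((f i \<circ> h i) v) = lab (G i) v"
      by (simp add: LK hV L)
  next
    fix i j v w
    assume ij: "i \<in> I" "j \<in> I" and vw: "v \<in> verts (G i)" "w \<in> verts (G j)"
      and eq: "(f i \<circ> h i) v = (f j \<circ> h j) w"
    have "(i = j \<and> h i v = h j w) \<or> lab (F i) (h i v) \<noteq> None"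
      using gluing_eq_iff[OF g ij hV[OF ij(1) vw(1)] hV[OF ij(2) vw(2)]] eq by auto
    then show "i = j \<and> v = w \<or> lab (G i) v \<noteq> None"
      using inj[OF ij(1)] vw L[OF ij(1) vw(1)] by (auto dest: inj_onD)
  qed (use wf in auto)
  then show ?thesis by blast
qed

lemma glue_vertex_inj:
  assumes "wf_pregraph G" "i \<noteq> 0"
  shows "inj (glue_vertex i G)"
proof (rule injI)
  fix v w assume "glue_vertex i G v = glue_vertex i G w"
  then show "v = w"
    using assms wf_lab_inj[OF assms(1)]
    by (auto simp: glue_vertex_def prod_encode_eq split: option.splits)
qed

lemma lab_glue_1:
  "lab (glue_pregraph G H) (glue_vertex 1 G v) = lab G v"
  by (auto simp: glue_pregraph_def glue_vertex_def ranI split: option.splits)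

lemma lab_glue_2:
  "lab (glue_pregraph G H) (glue_vertex 2 H v) = lab H v"
  by (auto simp: glue_pregraph_def glue_vertex_def ranI split: option.splits)

lemma wf_edge_image:
  assumes "wf_pregraph G" "inj f" "e \<in> edges G" "f ` verts G \<subseteq> V"
  shows "f ` e \<in> {{u, v} | u v. u \<in> V \<and> v \<in> V \<and> u \<noteq> v}"
proof -
  obtain u v where "e = {u, v}" "u \<in> verts G" "v \<in> verts G" "u \<noteq> v"
    using assms unfolding wf_pregraph_def by blast
  then show ?thesis
    using assms by (intro CollectI exI[of _ "f u"] exI[of _ "f v"]) (auto dest: injD)
qed

lemma wf_glue_pregraph:
  assumes G: "wf_pregraph G" and H: "wf_pregraph H"
  shows "wf_pregraph (glue_pregraph G H)"
proof -
  let ?K = "glue_pregraph G H" and ?f = "glue_vertex 1 G" and ?g = "glue_vertex 2 H"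
  have V: "verts ?K = ?f ` verts G \<union> ?g ` verts H"
    and E: "edges ?K = (`) ?f ` edges G \<union> (`) ?g ` edges H"
    by (simp_all add: glue_pregraph_def)
  have lab_eq: "lab ?K w = Some n \<longleftrightarrow> w = prod_encode (0, n) \<and> n \<in> ran (lab G) \<union> ran (lab H)" for w n
  proof -
    obtain i m where w: "w = prod_encode (i, m)"
      by (metis prod_decode_inverse surj_pair)
    show ?thesis unfolding w by (auto simp: glue_pregraph_def prod_encode_eq)
  qed
  have "finite (verts ?K)" using G H by (simp add: V wf_pregraph_def)
  moreover have "edges ?K \<subseteq> {{u, v} | u v. u \<in> verts ?K \<and> v \<in> verts ?K \<and> u \<noteq> v}"
  proof
    fix e assume "e \<in> edges ?K"
    then consider a where "a \<in> edges G" "e = ?f ` a" | a where "a \<in> edges H" "e = ?g ` a"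
      unfolding E by blast
    then show "e \<in> {{u, v} | u v. u \<in> verts ?K \<and> v \<in> verts ?K \<and> u \<noteq> v}"
    proof cases
      case 1
      then show ?thesis
        using wf_edge_image[OF G glue_vertex_inj[OF G], of 1 a "verts ?K"] by (simp add: V)
    next
      case 2
      then show ?thesis
        using wf_edge_image[OF H glue_vertex_inj[OF H], of 2 a "verts ?K"] by (simp add: V)
    qed
  qed
  moreover have "verts ?K \<subseteq> \<Union> (edges ?K)"
  proof -
    have "verts G \<subseteq> \<Union> (edges G)" "verts H \<subseteq> \<Union> (edges H)"
      using G H by (auto simp: wf_pregraph_def)
    then have "?f ` verts G \<subseteq> ?f ` \<Union> (edges G)" "?g ` verts H \<subseteq> ?g ` \<Union> (edges H)"
      by (auto intro: image_mono)
    then show ?thesis unfolding V E Union_Un_distrib image_Union by (rule Un_mono)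
  qed
  moreover have "dom (lab ?K) \<subseteq> verts ?K"
  proof
    fix w assume "w \<in> dom (lab ?K)"
    then obtain n where w: "w = prod_encode (0, n)" and n: "n \<in> ran (lab G) \<union> ran (lab H)"
      using lab_eq by blast
    from n consider v where "lab G v = Some n" | v where "lab H v = Some n"
      by (auto simp: ran_def)
    then show "w \<in> verts ?K"
    proof cases
      case 1
      then have "v \<in> verts G" "w = ?f v"
        using G w by (auto simp: wf_pregraph_def glue_vertex_def)
      then show ?thesis by (simp add: V)
    next
      case 2
      then have "v \<in> verts H" "w = ?g v"
        using H w by (auto simp: wf_pregraph_def glue_vertex_def)
      then show ?thesis by (simp add: V)
    qed
  qed
  moreover have "inj_on (lab ?K) (dom (lab ?K))"
    by (rule inj_onI) (metis (no_types) domD lab_eq)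
  moreover have "0 \<notin> ran (lab ?K)"
    using G H by (auto simp: ran_def lab_eq wf_pregraph_def)
  ultimately show ?thesis unfolding wf_pregraph_def by (intro conjI)
qed

lemma glue_vertex_12:
  "glue_vertex 1 G v = glue_vertex 2 H w \<Longrightarrow> lab G v \<noteq> None \<and> lab H w \<noteq> None"
  by (auto simp: glue_vertex_def prod_encode_eq split: option.splits)

lemma gluing_glue:
  assumes wf: "wf_pregraph (F i)" "wf_pregraph (F j)" and ij: "i \<noteq> j"
  shows "\<exists>f. gluing {i, j} F f (glue_pregraph (F i) (F j))"
proof -
  define f where "f l = (if l = i then glue_vertex 1 (F i) else glue_vertex 2 (F j))" for l
  have f [simp]: "f i = glue_vertex 1 (F i)" "f j = glue_vertex 2 (F j)"
    using ij by (auto simp: f_def)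
  have "gluing {i, j} F f (glue_pregraph (F i) (F j))"
    unfolding gluing_def
  proof (intro conjI ballI impI)
    show "wf_pregraph (glue_pregraph (F i) (F j))" by (rule wf_glue_pregraph[OF wf])
    show "verts (glue_pregraph (F i) (F j)) = (\<Union>l\<in>{i, j}. f l ` verts (F l))"
      by (simp add: glue_pregraph_def)
    show "edges (glue_pregraph (F i) (F j)) = (\<Union>l\<in>{i, j}. (`) (f l) ` edges (F l))"
      by (simp add: glue_pregraph_def)
  next
    fix l assume "l \<in> {i, j}"
    then show "wf_pregraph (F l)" using wf by auto
  next
    fix l v assume "l \<in> {i, j}"
    then show "lab (glue_pregraph (F i) (F j)) (f l v) = lab (F l) v"
      using lab_glue_1 lab_glue_2 by auto
  next
    fix l m v w assume lm: "l \<in> {i, j}" "m \<in> {i, j}" and eq: "f l v = f m w"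
    show "l = m \<and> v = w \<or> lab (F l) v \<noteq> None"
    proof (cases "l = m")
      case True
      then show ?thesis
        using lm eq glue_vertex_inj[OF wf(1), of 1] glue_vertex_inj[OF wf(2), of 2]
        by (auto dest: injD)
    next
      case False
      then have "l = i \<and> m = j \<or> l = j \<and> m = i" using lm by auto
      then show ?thesis
        using eq glue_vertex_12[of "F i" v "F j" w] glue_vertex_12[of "F i" w "F j" v] by auto
    qed
  qed
  then show ?thesis by blast
qed

(* Gluing the gluing M of the graphs with indices in I onto the graph with index j. *)

lemma gluing_insert:
  assumes g: "gluing I F f M" and wfj: "wf_pregraph (F j)" and j: "j \<notin> I"
    and K: "gluing {i, j} (F(i := M)) h K" and ij: "i \<noteq> j"
  shows "\<exists>f'. gluing (insert j I) F f' K"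
proof -
  define f' where "f' l = (if l = j then h j else h i \<circ> f l)" for l
  have f'j: "f' j = h j" and f'I: "\<And>l. l \<in> I \<Longrightarrow> f' l = h i \<circ> f l"
    using j by (auto simp: f'_def)
  have VM: "verts M = (\<Union>i\<in>I. f i ` verts (F i))"
    and EM: "edges M = (\<Union>i\<in>I. (`) (f i) ` edges (F i))"
    and LM: "\<And>l v. l \<in> I \<Longrightarrow> v \<in> verts (F l) \<Longrightarrow> lab M (f l v) = lab (F l) v"
    using g unfolding gluing_def by auto
  have fV: "f l v \<in> verts M" if "l \<in> I" "v \<in> verts (F l)" for l v
    using that unfolding VM by blast
  have VK: "verts K = h i ` verts M \<union> h j ` verts (F j)"
    and EK: "edges K = (`) (h i) ` edges M \<union> (`) (h j) ` edges (F j)"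
    using K ij unfolding gluing_def by auto
  have LKi: "lab K (h i x) = lab M x" if "x \<in> verts M" for x
    using K that ij unfolding gluing_def by auto
  have LKj: "lab K (h j x) = lab (F j) x" if "x \<in> verts (F j)" for x
    using K that ij unfolding gluing_def by auto
  have L: "lab K (f' l v) = lab (F l) v" if "l \<in> insert j I" "v \<in> verts (F l)" for l v
    using that by (auto simp: f'j f'I LKj LKi fV LM)
  have hii: "h i x = h i y \<Longrightarrow> x = y \<or> lab M x \<noteq> None" if "x \<in> verts M" "y \<in> verts M" for x y
    using gluing_eq_iff[OF K, of i i x y] that by auto
  have hjj: "h j x = h j y \<Longrightarrow> x = y \<or> lab (F j) x \<noteq> None"
    if "x \<in> verts (F j)" "y \<in> verts (F j)" for x y
    using gluing_eq_iff[OF K, of j j x y] that ij by auto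
  have hij: "h i x = h j y \<Longrightarrow> lab M x \<noteq> None \<and> lab (F j) y \<noteq> None"
    if "x \<in> verts M" "y \<in> verts (F j)" for x y
    using gluing_eq_iff[OF K, of i j x y] that ij by auto
  have "gluing (insert j I) F f' K"
    unfolding gluing_def
  proof (intro conjI ballI impI)
    show "wf_pregraph K" using K unfolding gluing_def by blast
    show "verts K = (\<Union>l\<in>insert j I. f' l ` verts (F l))"
      unfolding VK VM by (auto simp: f'j f'I)
    have "(\<Union>l\<in>I. (`) (f' l) ` edges (F l)) = (\<Union>l\<in>I. (`) (h i) ` (`) (f l) ` edges (F l))"
      by (intro SUP_cong refl) (simp add: f'I image_image)
    then show "edges K = (\<Union>l\<in>insert j I. (`) (f' l) ` edges (F l))"
      unfolding EK EM by (simp add: f'j image_UN Un_commute)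
  next
    fix l assume "l \<in> insert j I"
    then show "wf_pregraph (F l)" using wfj g unfolding gluing_def by auto
  next
    fix l v assume "l \<in> insert j I" "v \<in> verts (F l)"
    then show "lab K (f' l v) = lab (F l) v" by (rule L)
  next
    fix l m v w
    assume lm: "l \<in> insert j I" "m \<in> insert j I"
      and vw: "v \<in> verts (F l)" "w \<in> verts (F m)" and eq: "f' l v = f' m w"
    consider "l = j" "m = j" | "l = j" "m \<in> I" | "l \<in> I" "m = j" | "l \<in> I" "m \<in> I"
      using lm by blast
    then show "l = m \<and> v = w \<or> lab (F l) v \<noteq> None"
    proof cases
      case 1
      then show ?thesis using hjj[of v w] vw eq by (auto simp: f'j)
    next
      case 2
      then show ?thesis using hij[of "f m w" v] vw eq fV by (auto simp: f'j f'I)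
    next
      case 3
      then show ?thesis using hij[of "f l v" w] vw eq fV LM[of l v] by (auto simp: f'j f'I)
    next
      case 4
      then have "f l v = f m w \<or> lab (F l) v \<noteq> None"
        using hii[of "f l v" "f m w"] vw eq fV LM[of l v] by (auto simp: f'I)
      then show ?thesis using gluing_eq_iff[OF g 4 vw] by auto
    qed
  qed
  then show ?thesis by blast
qed

lemma glue_pregraph_cong:
  assumes "iso_pregraph G G'" "iso_pregraph H H'"
  shows "iso_pregraph (glue_pregraph G H) (glue_pregraph G' H')"
proof -
  define F where "F i = (if i = 0 then G else H)" for i :: nat
  define F' where "F' i = (if i = 0 then G' else H')" for i :: nat
  have wf: "wf_pregraph G" "wf_pregraph H" "wf_pregraph G'" "wf_pregraph H'"
    using assms by (auto simp: iso_pregraph_def)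
  obtain f where f: "gluing {0, 1} F f (glue_pregraph G H)"
    using gluing_glue[of F 0 1] wf by (auto simp: F_def)
  obtain f' where f': "gluing {0, 1} F' f' (glue_pregraph G' H')"
    using gluing_glue[of F' 0 1] wf by (auto simp: F'_def)
  obtain f'' where "gluing {0, 1} F f'' (glue_pregraph G' H')"
    using gluing_iso[OF f', of F] assms unfolding F_def F'_def by force
  with f show ?thesis by (rule gluing_unique)
qed

lemma glue_pregraph_commute:
  assumes "wf_pregraph G" "wf_pregraph H"
  shows "iso_pregraph (glue_pregraph G H) (glue_pregraph H G)"
proof -
  define F where "F i = (if i = 0 then G else H)" for i :: nat
  obtain f where f: "gluing {0, 1} F f (glue_pregraph G H)"
    using gluing_glue[of F 0 1] assms by (auto simp: F_def)
  obtain f' where "gluing {1, 0} F f' (glue_pregraph H G)"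
    using gluing_glue[of F 1 0] assms by (auto simp: F_def)
  then have "gluing {0, 1} F f' (glue_pregraph H G)" by (simp add: insert_commute)
  with f show ?thesis by (rule gluing_unique)
qed

lemma gluing_glue3:
  assumes wf: "wf_pregraph (F i)" "wf_pregraph (F j)" "wf_pregraph (F k)"
    and d: "i \<noteq> j" "i \<noteq> k" "j \<noteq> k"
  shows "\<exists>f. gluing {i, j, k} F f (glue_pregraph (glue_pregraph (F i) (F j)) (F k))"
proof -
  let ?M = "glue_pregraph (F i) (F j)"
  obtain f where f: "gluing {i, j} F f ?M"
    using gluing_glue[OF wf(1,2) d(1)] by blast
  have "\<exists>h. gluing {i, k} (F(i := ?M)) h (glue_pregraph ((F(i := ?M)) i) ((F(i := ?M)) k))"
    by (rule gluing_glue) (use wf d wf_glue_pregraph in auto)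
  then obtain h where h: "gluing {i, k} (F(i := ?M)) h (glue_pregraph ?M (F k))"
    using d by auto
  have "\<exists>f'. gluing (insert k {i, j}) F f' (glue_pregraph ?M (F k))"
    by (rule gluing_insert[OF f wf(3) _ h d(2)]) (use d in auto)
  then show ?thesis by (simp add: insert_commute)
qed

lemma glue_pregraph_assoc:
  assumes "wf_pregraph G" "wf_pregraph H" "wf_pregraph K"
  shows "iso_pregraph (glue_pregraph (glue_pregraph G H) K) (glue_pregraph G (glue_pregraph H K))"
proof -
  define F where "F i = (if i = 0 then G else if i = 1 then H else K)" for i :: nat
  have F [simp]: "F 0 = G" "F (Suc 0) = H" "F 2 = K" by (simp_all add: F_def)
  obtain f where f: "gluing {0, 1, 2} F f (glue_pregraph (glue_pregraph G H) K)"
    using gluing_glue3[of F 0 1 2] assms by auto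
  obtain f' where "gluing {1, 2, 0} F f' (glue_pregraph (glue_pregraph H K) G)"
    using gluing_glue3[of F 1 2 0] assms by auto
  then have "gluing {0, 1, 2} F f' (glue_pregraph (glue_pregraph H K) G)"
    by (simp add: insert_commute)
  with f have "iso_pregraph (glue_pregraph (glue_pregraph G H) K) (glue_pregraph (glue_pregraph H K) G)"
    by (rule gluing_unique)
  then show ?thesis
    by (rule iso_pregraph_trans) (intro glue_pregraph_commute wf_glue_pregraph assms)
qed

lemma wf_empty_pregraph: "wf_pregraph empty_pregraph"
  by (simp add: wf_pregraph_def empty_pregraph_def)

lemma glue_pregraph_empty:
  assumes G: "wf_pregraph G"
  shows "iso_pregraph (glue_pregraph empty_pregraph G) G"
proof -
  define F where "F i = (if i = 0 then empty_pregraph else G)" for i :: nat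
  obtain f where f: "gluing {0, 1} F f (glue_pregraph empty_pregraph G)"
    using gluing_glue[of F 0 1] G wf_empty_pregraph by (auto simp: F_def)
  have "gluing {0, 1} F (\<lambda>_ v. v) G"
    using G wf_empty_pregraph by (auto simp: gluing_def F_def empty_pregraph_def)
  with f show ?thesis by (rule gluing_unique)
qed

lemma unlabel_pregraph_cong:
  assumes "iso_pregraph G H"
  shows "iso_pregraph (unlabel_pregraph G) (unlabel_pregraph H)"
proof -
  have "wf_pregraph K \<Longrightarrow> wf_pregraph (unlabel_pregraph K)" for K
    by (simp add: unlabel_pregraph_def wf_pregraph_def)
  moreover have "\<exists>f. bij_betw f (verts G) (verts H) \<and> (`) f ` edges G = edges H"
    using assms unfolding iso_pregraph_def by blast
  ultimately show ?thesis
    using assms by (simp add: iso_pregraph_def) (simp add: unlabel_pregraph_def)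
qed

lemma iso_pregraph_lab_empty:
  assumes "iso_pregraph G H"
  shows "lab G = Map.empty \<longleftrightarrow> lab H = Map.empty"
proof -
  have *: "lab H = Map.empty" if GH: "iso_pregraph G H" "lab G = Map.empty" for G H
  proof -
    obtain f where f: "f ` verts G = verts H" "\<forall>v\<in>verts G. lab H (f v) = None"
      using GH by (auto simp: iso_pregraph_def bij_betw_def)
    have "dom (lab H) \<subseteq> verts H"
      using GH(1) by (simp add: iso_pregraph_def wf_pregraph_def)
    moreover have "\<forall>v\<in>verts H. lab H v = None"
      using f(2) unfolding f(1)[symmetric] by simp
    ultimately have "lab H x = None" for x by (meson domIff subsetD)
    then show ?thesis by (rule ext)
  qed
  show ?thesis using *[of G H] *[of H G] assms iso_pregraph_sym by blast
qed

lemma wf_path_pregraph: "wf_pregraph (path_pregraph k)"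
proof (cases k)
  case 0
  then show ?thesis by (simp add: path_pregraph_def wf_pregraph_def)
next
  case (Suc m)
  have "v \<in> \<Union> {{i, Suc i} | i. i < k}" if "v \<le> k" for v
  proof (cases v)
    case 0
    then have "v \<in> {0, Suc 0} \<and> 0 < k" using Suc by simp
    then show ?thesis by blast
  next
    case (Suc i)
    then have "v \<in> {i, Suc i} \<and> i < k" using that by simp
    then show ?thesis by blast
  qed
  then have "{..k} \<subseteq> \<Union> {{i, Suc i} | i. i < k}" by auto
  moreover have "{{i, Suc i} | i. i < k} \<subseteq> {{u, v} | u v. u \<in> {..k} \<and> v \<in> {..k} \<and> u \<noteq> v}"
  proof
    fix e assume "e \<in> {{i, Suc i} | i. i < k}"
    then obtain i where "e = {i, Suc i}" "i < k" by blast
    then show "e \<in> {{u, v} | u v. u \<in> {..k} \<and> v \<in> {..k} \<and> u \<noteq> v}"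
      by (intro CollectI exI[of _ i] exI[of _ "Suc i"]) auto
  qed
  ultimately show ?thesis using Suc by (simp add: path_pregraph_def wf_pregraph_def)
qed

lemma wf_edge_pregraph: "wf_pregraph edge_pregraph"
  by (auto simp: edge_pregraph_def wf_pregraph_def)


subsection \<open>Isomorphism classes and their product\<close>

quotient_type plgraph = pregraph / partial: iso_pregraph
proof (rule part_equivpI)
  show "\<exists>G. iso_pregraph G G"
    using iso_pregraph_refl[OF wf_empty_pregraph] by blast
  show "symp iso_pregraph" by (rule sympI) (rule iso_pregraph_sym)
  show "transp iso_pregraph" by (rule transpI) (rule iso_pregraph_trans)
qed

(* The gluing product is written additively, so that the library's product on finitely supported
   functions (\<Rightarrow>\<^sub>0) becomes the bilinear extension of the gluing product. *)

instantiation plgraph :: comm_monoid_add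
begin

lift_definition zero_plgraph :: plgraph is empty_pregraph
  by (rule iso_pregraph_refl[OF wf_empty_pregraph])

lift_definition plus_plgraph :: "plgraph \<Rightarrow> plgraph \<Rightarrow> plgraph" is glue_pregraph
  by (rule glue_pregraph_cong)

instance
proof
  fix G H K :: plgraph
  show "G + H + K = G + (H + K)"
    by transfer (rule glue_pregraph_assoc; simp add: iso_pregraph_def)
  show "G + H = H + G"
    by transfer (rule glue_pregraph_commute; simp add: iso_pregraph_def)
  show "0 + G = G"
    by transfer (rule glue_pregraph_empty; simp add: iso_pregraph_def)
qed

end

lift_definition unlabel :: "plgraph \<Rightarrow> plgraph" is unlabel_pregraph
  by (rule unlabel_pregraph_cong)

lift_definition unlabeled :: "plgraph \<Rightarrow> bool" is "\<lambda>G. lab G = Map.empty"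
  by (rule iso_pregraph_lab_empty)

lift_definition path_graph :: "nat \<Rightarrow> plgraph" is path_pregraph
  by (rule iso_pregraph_refl[OF wf_path_pregraph])

lift_definition edge_graph :: plgraph is edge_pregraph
  by (rule iso_pregraph_refl[OF wf_edge_pregraph])

lemma path_graph_1: "path_graph 1 = edge_graph"
proof -
  have "path_pregraph 1 = edge_pregraph"
    by (auto simp: path_pregraph_def edge_pregraph_def)
  then show ?thesis by (simp add: path_graph_def edge_graph_def)
qed

lemma unlabeled_unlabel: "unlabeled (unlabel G)"
  by transfer (simp add: unlabel_pregraph_def)


section \<open>The algebra of graph combinations\<close>

(* The unit is the empty graph: 1 = Poly_Mapping.single 0 1. *)

type_synonym graph_comb = "plgraph \<Rightarrow>\<^sub>0 real"

definition gc :: "plgraph \<Rightarrow> graph_comb" where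
  "gc G = Poly_Mapping.single G 1"

lemma gc_mult: "gc G * gc H = gc (G + H)"
  by (simp add: gc_def mult_single)

lemma gc_empty: "gc 0 = 1"
  by (simp add: gc_def)

definition unlabeled_combs :: "graph_comb set" where
  "unlabeled_combs = {a. \<forall>G \<in> Poly_Mapping.keys a. unlabeled G}"

definition unlabel_comb :: "graph_comb \<Rightarrow> graph_comb" where
  "unlabel_comb a = (\<Sum>G \<in> Poly_Mapping.keys a. Poly_Mapping.lookup a G *\<^sub>R gc (unlabel G))"

lemma unlabel_comb_unlabeled: "unlabel_comb a \<in> unlabeled_combs"
proof -
  have "Poly_Mapping.lookup (unlabel_comb a) G = 0" if "\<not> unlabeled G" for G
    unfolding unlabel_comb_def lookup_sum
  proof (rule sum.neutral, rule ballI)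
    fix H
    have "unlabel H \<noteq> G" using that unlabeled_unlabel by blast
    then have "Poly_Mapping.lookup (gc (unlabel H)) G = 0"
      by (simp add: gc_def lookup_single)
    then show "Poly_Mapping.lookup (Poly_Mapping.lookup a H *\<^sub>R gc (unlabel H)) G = 0"
      by (simp add: scaleR_poly_mapping_def)
  qed
  then show ?thesis unfolding unlabeled_combs_def by (auto simp: in_keys_iff)
qed

definition sos :: "graph_comb \<Rightarrow> bool" where
  "sos g \<longleftrightarrow> g \<in> unlabeled_combs \<and>
     (\<exists>as :: graph_comb list. g = (\<Sum>a\<leftarrow>as. unlabel_comb (a\<^sup>2)))"

end

theory Submission
  imports Defs
begin

text \<open>
  Suppose \<open>T = (\<lambda> P\<^sub>k - e\<^sup>k)(1 + g) = \<Sum>\<^sub>i [[a\<^sub>i\<^sup>2]]\<close>. Among the graphs with at most \<open>k\<close> edges, only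
  \<open>P\<^sub>k\<close> and \<open>e\<^sup>k\<close> can occur in \<open>T\<close>, and \<open>e\<^sup>k\<close> has a negative coefficient. The number of edges
  satisfies \<open>|E(G\<^sup>2)| + |E(H\<^sup>2)| \<le> 2 |E(GH)|\<close>, and so does the number of vertices, with equality only
  if \<open>G\<close> and \<open>H\<close> carry the same labels; in that case homomorphism counts satisfy a Cauchy-Schwarz
  inequality, whose equality case forces \<open>G = H\<close> once there are enough targets.

  Consider the graphs \<open>H\<close> in the supports of the \<open>a\<^sub>i\<close> with \<open>|E(H\<^sup>2)| \<le> k\<close> and \<open>[[H\<^sup>2]] \<noteq> P\<^sub>k\<close>. If there
  is one, take one for which \<open>H\<^sup>2\<close> has the fewest edges, then the fewest vertices, then the most
  homomorphisms. By the inequalities, \<open>[[H\<^sup>2]]\<close> arises only from diagonal products, so its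
  coefficient in \<open>T\<close> is positive, which is impossible. Hence \<open>|E(H\<^sup>2)| \<le> k\<close> implies \<open>[[H\<^sup>2]] = P\<^sub>k\<close>. As
  \<open>k\<close> is odd, this only happens for a fully labeled path: exchanging the two copies of \<open>H\<close> is an
  automorphism of \<open>P\<^sub>k\<close>, and the reversal of \<open>P\<^sub>k\<close> flips the middle edge, which no exchange can do.
  A product of such an \<open>H\<close> with at most \<open>k\<close> edges is again \<open>P\<^sub>k\<close>, so \<open>e\<^sup>k\<close> cannot arise at all.
\<close>

section \<open>Counting edges and vertices of gluings\<close>

text \<open>\<open>A\<close>, \<open>A'\<close> stand for the two copies of one factor in its square
  and \<open>B\<close>, \<open>B'\<close> for those of the other. After inclusion-exclusion the
  claim reads \<open>2 * card (L \<inter> M) \<le> card L + card M\<close>, which is tight only if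
  \<open>L\<close> and \<open>M\<close> both equal their intersection.\<close>

lemma card_overlap:
  fixes A A' B B' :: "'a set"
  assumes fin: "finite A" "finite A'" "finite B" "finite B'"
    and card: "card A = card A'" "card B = card B'"
    and int: "A \<inter> A' = L" "B \<inter> B' = M" "A \<inter> B' = L \<inter> M"
  shows "card (A \<union> A') + card (B \<union> B') \<le> 2 * card (A \<union> B')"
    and "card (A \<union> A') + card (B \<union> B') = 2 * card (A \<union> B') \<Longrightarrow> L = M"
proof -
  have finLM: "finite L" "finite M" using fin int by auto
  have "card A + card A' = card (A \<union> A') + card L" "card B + card B' = card (B \<union> B') + card M"
    "card A + card B' = card (A \<union> B') + card (L \<inter> M)"
    using card_Un_Int[of A A'] card_Un_Int[of B B'] card_Un_Int[of A B'] fin int by auto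
  then have eq: "card (A \<union> A') + card (B \<union> B') + (card L + card M) =
      2 * card (A \<union> B') + 2 * card (L \<inter> M)"
    using card by simp
  have le: "card (L \<inter> M) \<le> card L" "card (L \<inter> M) \<le> card M"
    using finLM by (auto intro: card_mono)
  show "card (A \<union> A') + card (B \<union> B') \<le> 2 * card (A \<union> B')"
    using eq le by linarith
  assume "card (A \<union> A') + card (B \<union> B') = 2 * card (A \<union> B')"
  then have "card (L \<inter> M) = card L" "card (L \<inter> M) = card M"
    using eq le by linarith+
  then have "L \<inter> M = L" "L \<inter> M = M"
    using finLM by (simp_all add: card_subset_eq)
  then show "L = M" by simp
qed

lemma glue_vertex_Some: "lab G v = Some n \<Longrightarrow> glue_vertex i G v = prod_encode (0, n)"
  by (simp add: glue_vertex_def)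

lemma glue_vertex_labeled_iff:
  "i \<noteq> 0 \<Longrightarrow> glue_vertex i G v \<in> range (\<lambda>n. prod_encode (0, n)) \<longleftrightarrow> lab G v \<noteq> None"
  by (auto simp: glue_vertex_def prod_encode_eq split: option.splits)

lemma wf_finite_verts: "wf_pregraph G \<Longrightarrow> finite (verts G)"
  by (simp add: wf_pregraph_def)

lemma wf_finite_edges: "wf_pregraph G \<Longrightarrow> finite (edges G)"
  using wf_pregraph_edgeD[of G] wf_finite_verts[of G]
  by (meson Pow_iff finite_Pow_iff finite_subset subsetI)

lemma wf_Union_edges: "wf_pregraph G \<Longrightarrow> \<Union> (edges G) = verts G"
  using wf_pregraph_edgeD[of G] by (auto simp: wf_pregraph_def)

lemma wf_edge_pair:
  "wf_pregraph G \<Longrightarrow> e \<in> edges G \<Longrightarrow> \<exists>u v. e = {u, v} \<and> u \<in> verts G \<and> v \<in> verts G \<and> u \<noteq> v"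
  unfolding wf_pregraph_def by blast

lemma wf_labeled_vert: "wf_pregraph G \<Longrightarrow> lab G v = Some n \<Longrightarrow> v \<in> verts G"
  unfolding wf_pregraph_def by blast

lemma verts_glue:
  "verts (glue_pregraph G H) = glue_vertex 1 G ` verts G \<union> glue_vertex 2 H ` verts H"
  by (simp add: glue_pregraph_def)

lemma edges_glue:
  "edges (glue_pregraph G H) = (`) (glue_vertex 1 G) ` edges G \<union> (`) (glue_vertex 2 H) ` edges H"
  by (simp add: glue_pregraph_def)

text \<open>Only vertices with a common label are identified. For equal graphs the right side
  collapses to one label set, so the same formula supplies all three intersections that
  \<open>card_overlap\<close> requires.\<close>

lemma glue_verts_Int:
  assumes "wf_pregraph G" "wf_pregraph H"
  shows "glue_vertex 1 G ` verts G \<inter> glue_vertex 2 H ` verts H =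
    (\<lambda>n. prod_encode (0, n)) ` ran (lab G) \<inter> (\<lambda>n. prod_encode (0, n)) ` ran (lab H)"
    (is "?L = ?R")
proof
  show "?L \<subseteq> ?R"
  proof
    fix x assume "x \<in> ?L"
    then obtain v w where x: "x = glue_vertex 1 G v" "x = glue_vertex 2 H w" by blast
    then obtain m n where "lab G v = Some m" "lab H w = Some n"
      using glue_vertex_12[of G v H w] by auto
    then show "x \<in> ?R" using x by (auto simp: glue_vertex_Some ranI)
  qed
  show "?R \<subseteq> ?L"
  proof
    fix x assume "x \<in> ?R"
    then obtain n v w where "x = prod_encode (0, n)" "lab G v = Some n" "lab H w = Some n"
      by (auto simp: ran_def prod_encode_eq)
    moreover from this have "v \<in> verts G" "w \<in> verts H"
      using assms by (auto intro: wf_labeled_vert)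
    ultimately show "x \<in> ?L" by (force simp: glue_vertex_Some)
  qed
qed

lemma card_glue_vertex_image:
  "wf_pregraph G \<Longrightarrow> i \<noteq> 0 \<Longrightarrow> card (glue_vertex i G ` X) = card X"
  by (meson card_image glue_vertex_inj inj_on_subset subset_UNIV)

lemma card_glue_edge_image:
  "wf_pregraph G \<Longrightarrow> i \<noteq> 0 \<Longrightarrow> card ((`) (glue_vertex i G) ` X) = card X"
  by (meson card_image glue_vertex_inj inj_on_subset subset_UNIV inj_image_eq_iff inj_onI)

text \<open>\<open>card_overlap\<close> applies with the encoded label sets as \<open>L\<close> and
  \<open>M\<close>; the encoding is injective, so its equality case carries over to the
  labels.\<close>

lemma card_verts_glue:
  assumes "wf_pregraph G" "wf_pregraph H"
  shows "card (verts (glue_pregraph G G)) + card (verts (glue_pregraph H H))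
      \<le> 2 * card (verts (glue_pregraph G H))"
    and "card (verts (glue_pregraph G G)) + card (verts (glue_pregraph H H))
      = 2 * card (verts (glue_pregraph G H)) \<Longrightarrow> ran (lab G) = ran (lab H)"
proof -
  let ?c = "\<lambda>G. (\<lambda>n. prod_encode (0, n)) ` ran (lab G)"
  note * = card_overlap[OF _ _ _ _ _ _ glue_verts_Int[OF assms(1,1), unfolded Int_absorb]
      glue_verts_Int[OF assms(2,2), unfolded Int_absorb] glue_verts_Int[OF assms], folded verts_glue]
  note fin = assms wf_finite_verts card_glue_vertex_image
  show "card (verts (glue_pregraph G G)) + card (verts (glue_pregraph H H))
      \<le> 2 * card (verts (glue_pregraph G H))"
    by (rule *(1)) (simp_all add: fin)
  assume eq: "card (verts (glue_pregraph G G)) + card (verts (glue_pregraph H H))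
      = 2 * card (verts (glue_pregraph G H))"
  have "?c G = ?c H"
    by (rule *(2)) (simp_all add: fin eq)
  moreover have "inj (\<lambda>n. prod_encode (0, n))" by (auto intro: injI simp: prod_encode_eq)
  ultimately show "ran (lab G) = ran (lab H)" by (simp add: inj_image_eq_iff)
qed

text \<open>An edge is shared only if both its ends are labeled. Such an edge has the same name in
  either copy, so index 1 serves for both graphs and the overlap takes the form
  \<open>L \<inter> M\<close>.\<close>

lemma glue_edges_Int:
  assumes "wf_pregraph G" "wf_pregraph H"
  defines "labeled \<equiv> \<lambda>G. {e \<in> (`) (glue_vertex 1 G) ` edges G. e \<subseteq> range (\<lambda>n. prod_encode (0, n))}"
  shows "(`) (glue_vertex 1 G) ` edges G \<inter> (`) (glue_vertex 2 H) ` edges H = labeled G \<inter> labeled H"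
    (is "?L = ?R")
proof
  have 12: "glue_vertex 1 K ` e = glue_vertex 2 K ` e"
    if "glue_vertex i K ` e \<subseteq> range (\<lambda>n. prod_encode (0, n))" "i \<noteq> 0" for i K e
  proof (rule image_cong[OF refl])
    fix v assume "v \<in> e"
    then have "lab K v \<noteq> None" using that glue_vertex_labeled_iff by blast
    then show "glue_vertex 1 K v = glue_vertex 2 K v" by (auto simp: glue_vertex_Some)
  qed
  show "?L \<subseteq> ?R"
  proof
    fix x assume "x \<in> ?L"
    then obtain e f where x: "x = glue_vertex 1 G ` e" "e \<in> edges G"
      "x = glue_vertex 2 H ` f" "f \<in> edges H" by blast
    have "x \<subseteq> range (\<lambda>n. prod_encode (0, n))"
    proof
      fix y assume "y \<in> x"
      then obtain v w where y: "y = glue_vertex 1 G v" "y = glue_vertex 2 H w" using x by blast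
      then show "y \<in> range (\<lambda>n. prod_encode (0, n))"
        using glue_vertex_12[of G v H w] glue_vertex_labeled_iff[of 1 G v] by auto
    qed
    moreover from this have "x = glue_vertex 1 H ` f" using x 12[of 2 H f] by simp
    then have "x \<in> (`) (glue_vertex 1 H) ` edges H" using x(4) by (rule image_eqI)
    moreover have "x \<in> (`) (glue_vertex 1 G) ` edges G" using x(1,2) by (rule image_eqI)
    ultimately show "x \<in> ?R" by (simp add: labeled_def)
  qed
  show "?R \<subseteq> ?L"
  proof
    fix x assume x: "x \<in> ?R"
    then obtain f where f: "x = glue_vertex 1 H ` f" "f \<in> edges H" by (auto simp: labeled_def)
    then have "x = glue_vertex 2 H ` f" using x 12[of 1 H f] by (simp add: labeled_def)
    then have "x \<in> (`) (glue_vertex 2 H) ` edges H" using f(2) by (rule image_eqI)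
    then show "x \<in> ?L" using x by (simp add: labeled_def)
  qed
qed

lemma card_edges_glue:
  assumes "wf_pregraph G" "wf_pregraph H"
  shows "card (edges (glue_pregraph G G)) + card (edges (glue_pregraph H H))
      \<le> 2 * card (edges (glue_pregraph G H))"
  unfolding edges_glue
  by (rule card_overlap(1)[OF _ _ _ _ _ _ glue_edges_Int[OF assms(1,1), unfolded Int_absorb]
        glue_edges_Int[OF assms(2,2), unfolded Int_absorb] glue_edges_Int[OF assms]])
     (use assms in \<open>simp_all add: wf_finite_edges card_glue_edge_image\<close>)

section \<open>Homomorphism counts\<close>

text \<open>The target has vertex set \<open>B\<close> and an arbitrary family \<open>R\<close> of
  vertex sets as edges. Singletons in \<open>R\<close> act as loops, so an edge may collapse; labels
  are ignored.\<close>

definition hom_set :: "nat set \<Rightarrow> nat set set \<Rightarrow> pregraph \<Rightarrow> (nat \<Rightarrow> nat) set" where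
  "hom_set B R G = {\<psi> \<in> verts G \<rightarrow>\<^sub>E B. \<forall>e\<in>edges G. \<psi> ` e \<in> R}"

text \<open>\<open>\<phi>\<close> prescribes images of labels rather than of vertices, so the same
  \<open>\<phi>\<close> can be imposed on two different graphs.\<close>

definition hom_ext :: "nat set \<Rightarrow> nat set set \<Rightarrow> (nat \<Rightarrow> nat) \<Rightarrow> pregraph \<Rightarrow> (nat \<Rightarrow> nat) set" where
  "hom_ext B R \<phi> G = {\<psi> \<in> hom_set B R G. \<forall>v n. lab G v = Some n \<longrightarrow> \<psi> v = \<phi> n}"

lemma finite_hom_ext: "finite B \<Longrightarrow> wf_pregraph G \<Longrightarrow> finite (hom_ext B R \<phi> G)"
  unfolding hom_ext_def hom_set_def by (simp add: finite_PiE wf_finite_verts)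

text \<open>Once the images of the labels are fixed, the two factors are mapped independently. For
  equal label sets this makes the count an inner product of vectors of extension numbers, ready for
  Cauchy-Schwarz.\<close>

lemma card_hom_set_glue:
  assumes wf: "wf_pregraph G" "wf_pregraph H" and B: "finite B"
    and S: "ran (lab G) = S" "ran (lab H) = S"
  shows "card (hom_set B R (glue_pregraph G H)) =
    (\<Sum>\<phi>\<in>S \<rightarrow>\<^sub>E B. card (hom_ext B R \<phi> G) * card (hom_ext B R \<phi> H))"
proof -
  let ?K = "glue_pregraph G H"
  define T where "T = (SIGMA \<phi>:S \<rightarrow>\<^sub>E B. hom_ext B R \<phi> G \<times> hom_ext B R \<phi> H)"
  define p where "p \<psi> = (restrict (\<lambda>n. \<psi> (prod_encode (0, n))) S,
      restrict (\<lambda>v. \<psi> (glue_vertex 1 G v)) (verts G),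
      restrict (\<lambda>v. \<psi> (glue_vertex 2 H v)) (verts H))" for \<psi> :: "nat \<Rightarrow> nat"
  \<comment> \<open>The inverse of \<open>p\<close>. The first component of a vertex code tells its
    origin: 0 for a label, 1 and 2 for the unlabeled vertices of the two factors.\<close>
  define q where "q = (\<lambda>(\<phi>, \<psi>1, \<psi>2). restrict (\<lambda>w. case prod_decode w of (i, n) \<Rightarrow>
      (if i = 0 then \<phi> else if i = 1 then \<psi>1 else \<psi>2 :: nat \<Rightarrow> nat) n) (verts ?K))"
  have labK: "prod_encode (0, n) \<in> verts ?K" if n: "n \<in> S" for n
  proof -
    obtain v where "lab G v = Some n" using n S(1) unfolding ran_def by blast
    then have "v \<in> verts G" "glue_vertex 1 G v = prod_encode (0, n)"
      using wf by (auto simp: glue_vertex_Some intro: wf_labeled_vert)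
    then show ?thesis by (force simp: verts_glue)
  qed
  have S': "n \<in> S" if "lab G v = Some n \<or> lab H v = Some n" for n v
    using that S by (auto simp: ran_def)
  have finS: "finite S"
  proof -
    have "S \<subseteq> (\<lambda>v. the (lab G v)) ` verts G"
      unfolding S(1)[symmetric] ran_def using wf(1) wf_labeled_vert by force
    then show ?thesis using wf(1) by (meson finite_imageI finite_subset wf_finite_verts)
  qed
  have vertsK: "v \<in> verts G \<Longrightarrow> glue_vertex 1 G v \<in> verts ?K" "v \<in> verts H \<Longrightarrow> glue_vertex 2 H v \<in> verts ?K" for v
    by (auto simp: verts_glue)
  have q1: "q (\<phi>, \<psi>1, \<psi>2) (glue_vertex 1 G v) = \<psi>1 v"
    if "v \<in> verts G" "\<psi>1 \<in> hom_ext B R \<phi> G" for \<phi> \<psi>1 \<psi>2 v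
    using that vertsK(1)[OF that(1)] unfolding q_def by (cases "lab G v") (auto simp: glue_vertex_def hom_ext_def)
  have q2: "q (\<phi>, \<psi>1, \<psi>2) (glue_vertex 2 H v) = \<psi>2 v"
    if "v \<in> verts H" "\<psi>2 \<in> hom_ext B R \<phi> H" for \<phi> \<psi>1 \<psi>2 v
    using that vertsK(2)[OF that(1)] unfolding q_def by (cases "lab H v") (auto simp: glue_vertex_def hom_ext_def)
  have p_in: "p \<psi> \<in> T" if \<psi>: "\<psi> \<in> hom_set B R ?K" for \<psi>
  proof -
    have V: "\<psi> (glue_vertex 1 G v) \<in> B" if "v \<in> verts G" for v
      using \<psi> that by (auto simp: hom_set_def verts_glue)
    have W: "\<psi> (glue_vertex 2 H v) \<in> B" if "v \<in> verts H" for v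
      using \<psi> that by (auto simp: hom_set_def verts_glue)
    have "\<psi> (prod_encode (0, n)) \<in> B" if "n \<in> S" for n
      using \<psi> labK[OF that] by (auto simp: hom_set_def)
    then have 0: "fst (p \<psi>) \<in> S \<rightarrow>\<^sub>E B" by (auto simp: p_def)
    have "(\<lambda>v\<in>verts G. \<psi> (glue_vertex 1 G v)) ` e = \<psi> ` glue_vertex 1 G ` e" if "e \<in> edges G" for e
      using wf_pregraph_edgeD[OF wf(1) that] by (force simp: image_image)
    then have "(\<lambda>v\<in>verts G. \<psi> (glue_vertex 1 G v)) \<in> hom_set B R G"
      using \<psi> V unfolding hom_set_def edges_glue by auto
    moreover have "(\<lambda>v\<in>verts G. \<psi> (glue_vertex 1 G v)) v = fst (p \<psi>) n" if "lab G v = Some n" for v n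
      using that S'[of v n] wf_labeled_vert[OF wf(1) that] by (simp add: p_def glue_vertex_Some)
    ultimately have 1: "(\<lambda>v\<in>verts G. \<psi> (glue_vertex 1 G v)) \<in> hom_ext B R (fst (p \<psi>)) G"
      by (simp add: hom_ext_def)
    have "(\<lambda>v\<in>verts H. \<psi> (glue_vertex 2 H v)) ` e = \<psi> ` glue_vertex 2 H ` e" if "e \<in> edges H" for e
      using wf_pregraph_edgeD[OF wf(2) that] by (force simp: image_image)
    then have "(\<lambda>v\<in>verts H. \<psi> (glue_vertex 2 H v)) \<in> hom_set B R H"
      using \<psi> W unfolding hom_set_def edges_glue by auto
    moreover have "(\<lambda>v\<in>verts H. \<psi> (glue_vertex 2 H v)) v = fst (p \<psi>) n" if "lab H v = Some n" for v n
      using that S'[of v n] wf_labeled_vert[OF wf(2) that] by (simp add: p_def glue_vertex_Some)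
    ultimately have 2: "(\<lambda>v\<in>verts H. \<psi> (glue_vertex 2 H v)) \<in> hom_ext B R (fst (p \<psi>)) H"
      by (simp add: hom_ext_def)
    show ?thesis using 0 1 2 by (simp add: T_def p_def)
  qed
  have q_in: "q (\<phi>, \<psi>1, \<psi>2) \<in> hom_set B R ?K" and pq: "p (q (\<phi>, \<psi>1, \<psi>2)) = (\<phi>, \<psi>1, \<psi>2)"
    if t: "(\<phi>, \<psi>1, \<psi>2) \<in> T" for \<phi> \<psi>1 \<psi>2
  proof -
    let ?\<psi> = "q (\<phi>, \<psi>1, \<psi>2)"
    have \<phi>: "\<phi> \<in> S \<rightarrow>\<^sub>E B" and \<psi>: "\<psi>1 \<in> hom_ext B R \<phi> G" "\<psi>2 \<in> hom_ext B R \<phi> H"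
      using t by (auto simp: T_def)
    have PiE: "\<psi>1 \<in> verts G \<rightarrow>\<^sub>E B" "\<psi>2 \<in> verts H \<rightarrow>\<^sub>E B"
      using \<psi> by (auto simp: hom_ext_def hom_set_def)
    note q1' = q1[OF _ \<psi>(1)] and q2' = q2[OF _ \<psi>(2)]
    have "?\<psi> \<in> verts ?K \<rightarrow>\<^sub>E B"
    proof (rule PiE_I)
      fix w assume "w \<in> verts ?K"
      then show "?\<psi> w \<in> B" using PiE q1' q2' by (auto simp: verts_glue simp del: One_nat_def)
    qed (simp add: q_def)
    moreover have "?\<psi> ` glue_vertex 1 G ` e = \<psi>1 ` e" if "e \<in> edges G" for e
      using wf_pregraph_edgeD[OF wf(1) that] q1' unfolding image_image by (intro image_cong refl) auto
    moreover have "?\<psi> ` glue_vertex 2 H ` e = \<psi>2 ` e" if "e \<in> edges H" for e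
      using wf_pregraph_edgeD[OF wf(2) that] q2' unfolding image_image by (intro image_cong refl) auto
    ultimately show "?\<psi> \<in> hom_set B R ?K"
      using \<psi> by (auto simp: hom_ext_def hom_set_def edges_glue simp del: One_nat_def)
    have "(\<lambda>n\<in>S. ?\<psi> (prod_encode (0, n))) = \<phi>"
      by (rule PiE_ext[OF _ \<phi>]) (use \<phi> labK in \<open>auto simp: q_def\<close>)
    moreover have "(\<lambda>v\<in>verts G. ?\<psi> (glue_vertex 1 G v)) = \<psi>1"
      by (rule PiE_ext[OF _ PiE(1)]) (use PiE q1' in \<open>auto simp del: One_nat_def\<close>)
    moreover have "(\<lambda>v\<in>verts H. ?\<psi> (glue_vertex 2 H v)) = \<psi>2"
      by (rule PiE_ext[OF _ PiE(2)]) (use PiE q2' in \<open>auto simp del: One_nat_def\<close>)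
    ultimately show "p ?\<psi> = (\<phi>, \<psi>1, \<psi>2)" by (simp add: p_def)
  qed
  have qp: "q (p \<psi>) = \<psi>" if \<psi>: "\<psi> \<in> hom_set B R ?K" for \<psi>
  proof (rule PiE_ext)
    show "\<psi> \<in> verts ?K \<rightarrow>\<^sub>E B" using \<psi> by (simp add: hom_set_def)
    show "q (p \<psi>) \<in> verts ?K \<rightarrow>\<^sub>E B"
      using q_in[of "fst (p \<psi>)" "fst (snd (p \<psi>))" "snd (snd (p \<psi>))"] p_in[OF \<psi>]
      by (simp add: hom_set_def)
    fix w assume w: "w \<in> verts ?K"
    have T: "(fst (p \<psi>), fst (snd (p \<psi>)), snd (snd (p \<psi>))) \<in> T" using p_in[OF \<psi>] by simp
    then have h: "fst (snd (p \<psi>)) \<in> hom_ext B R (fst (p \<psi>)) G" "snd (snd (p \<psi>)) \<in> hom_ext B R (fst (p \<psi>)) H"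
      by (auto simp: T_def)
    from w consider v where "v \<in> verts G" "w = glue_vertex 1 G v"
      | v where "v \<in> verts H" "w = glue_vertex 2 H v"
      by (auto simp: verts_glue)
    then show "q (p \<psi>) w = \<psi> w"
    proof cases
      case 1
      then show ?thesis using q1[OF _ h(1), of v "snd (snd (p \<psi>))"] by (simp add: p_def)
    next
      case 2
      then show ?thesis using q2[OF _ h(2), of v "fst (snd (p \<psi>))"] by (simp add: p_def)
    qed
  qed
  have "bij_betw p (hom_set B R ?K) T"
    by (rule bij_betw_byWitness[where f' = q]) (use p_in q_in pq qp in auto)
  then have "card (hom_set B R ?K) = card T" by (rule bij_betw_same_card)
  also have "\<dots> = (\<Sum>\<phi>\<in>S \<rightarrow>\<^sub>E B. card (hom_ext B R \<phi> G \<times> hom_ext B R \<phi> H))"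
    unfolding T_def using finS B wf by (intro card_SigmaI finite_PiE) (auto simp: finite_hom_ext)
  finally show ?thesis by (simp add: card_cartesian_product)
qed

text \<open>Summing over all edge families \<open>R\<close> on \<open>B\<close> keeps the count an
  inner product, now indexed by pairs \<open>(R, \<phi>)\<close>; one comparison of numbers then
  controls every target at once.\<close>

definition hom_total :: "nat set \<Rightarrow> pregraph \<Rightarrow> nat" where
  "hom_total B G = (\<Sum>R\<in>Pow (Pow B). card (hom_set B R G))"

text \<open>
  Inclusion-exclusion over the sets of target edges turns equal numbers of homomorphisms into equal
  numbers of edge-surjective ones; the identity then yields an edge-surjective homomorphism in each
  direction.
\<close>

lemma iso_of_hom_ext:
  assumes wf: "wf_pregraph G" "wf_pregraph H" and fin: "finite B"
    and B: "verts G \<subseteq> B" "verts H \<subseteq> B" and ran: "ran (lab G) = ran (lab H)"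
    and eq: "\<And>R \<phi>. R \<subseteq> Pow B \<Longrightarrow> \<phi> \<in> ran (lab G) \<rightarrow>\<^sub>E B \<Longrightarrow> card (hom_ext B R \<phi> G) = card (hom_ext B R \<phi> H)"
  shows "iso_pregraph H G"
proof -
  define onto where "onto R \<phi> G = {\<psi> \<in> hom_ext B R \<phi> G. (`) \<psi> ` edges G = R}" for R \<phi> G
  have fin_onto: "finite (onto R \<phi> K)" if "wf_pregraph K" for R \<phi> K
    using finite_hom_ext[OF fin that] by (simp add: onto_def)
  have split: "card (hom_ext B R \<phi> K) = (\<Sum>R'\<in>Pow R. card (onto R' \<phi> K))"
    if "R \<subseteq> Pow B" "wf_pregraph K" for R \<phi> K
  proof -
    have "hom_ext B R \<phi> K = (\<Union>R'\<in>Pow R. onto R' \<phi> K)"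
      by (auto simp: onto_def hom_ext_def hom_set_def)
    moreover have "finite (Pow R)" using that fin by (simp add: finite_subset)
    ultimately show ?thesis using fin_onto[OF that(2)]
      by (simp add: card_UN_disjoint onto_def disjoint_iff)
  qed
  have onto_eq: "card (onto R \<phi> G) = card (onto R \<phi> H)"
    if "R \<subseteq> Pow B" "\<phi> \<in> ran (lab G) \<rightarrow>\<^sub>E B" for R \<phi>
  proof -
    have "finite R" using that fin by (simp add: finite_subset)
    \<comment> \<open>Once all proper subsets of \<open>R\<close> have equal counts, equality of the
      totals leaves equality for \<open>R\<close> itself.\<close>
    then show ?thesis using that(1)
    proof (induction R rule: finite_psubset_induct)
      case (psubset R)
      have "(\<Sum>R'\<in>Pow R. card (onto R' \<phi> G)) = (\<Sum>R'\<in>Pow R. card (onto R' \<phi> H))"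
        using split[OF psubset.prems] eq[OF psubset.prems that(2)] wf by simp
      moreover have "(\<Sum>R'\<in>Pow R - {R}. card (onto R' \<phi> G)) = (\<Sum>R'\<in>Pow R - {R}. card (onto R' \<phi> H))"
        by (rule sum.cong) (use psubset in auto)
      ultimately show ?case using psubset.hyps by (simp add: sum.remove[of "Pow R" R])
    qed
  qed
  have ex: "\<exists>\<psi>. \<psi> ` verts K' = verts K \<and> (`) \<psi> ` edges K' = edges K \<and>
      (\<forall>v n. lab K' v = Some n \<longrightarrow> lab K (\<psi> v) = Some n)"
    if K: "wf_pregraph K" "wf_pregraph K'" "verts K \<subseteq> B"
      and ran': "ran (lab K) = ran (lab K')" "ran (lab K) = ran (lab G)"
      and eq': "\<And>R \<phi>. R \<subseteq> Pow B \<Longrightarrow> \<phi> \<in> ran (lab G) \<rightarrow>\<^sub>E B \<Longrightarrow> card (onto R \<phi> K) = card (onto R \<phi> K')"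
    for K K'
  proof -
    \<comment> \<open>Take \<open>K\<close> itself as target and send each label to the vertex
      carrying it; the identity is then an edge-surjective homomorphism.\<close>
    define \<phi> where "\<phi> = (\<lambda>n\<in>ran (lab K). THE v. lab K v = Some n)"
    have \<phi>: "\<phi> n = v" if "lab K v = Some n" for n v
      using that wf_lab_inj[OF K(1)] by (auto simp: \<phi>_def ranI intro!: the_equality)
    have lab\<phi>: "lab K (\<phi> n) = Some n" if "n \<in> ran (lab K)" for n
      using that \<phi> by (auto simp: ran_def)
    have \<phi>B: "\<phi> \<in> ran (lab G) \<rightarrow>\<^sub>E B"
    proof (rule PiE_I)
      fix n assume "n \<in> ran (lab G)"
      then show "\<phi> n \<in> B" using lab\<phi> ran'(2) wf_labeled_vert[OF K(1)] K(3) by blast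
    qed (use ran' in \<open>simp add: \<phi>_def\<close>)
    have R: "edges K \<subseteq> Pow B" using wf_pregraph_edgeD[OF K(1)] K(3) by blast
    let ?i = "\<lambda>v\<in>verts K. v"
    have i: "?i ` e = e" if "e \<in> edges K" for e
      using wf_pregraph_edgeD[OF K(1) that] by force
    then have "(`) ?i ` edges K = edges K" by simp
    then have "?i \<in> onto (edges K) \<phi> K"
      using i K wf_labeled_vert[OF K(1)] \<phi> by (auto simp: onto_def hom_ext_def hom_set_def)
    then have "card (onto (edges K) \<phi> K) \<noteq> 0" using fin_onto[OF K(1)] by auto
    then have "card (onto (edges K) \<phi> K') \<noteq> 0" using eq'[OF R \<phi>B] by simp
    then obtain \<psi> where \<psi>: "\<psi> \<in> onto (edges K) \<phi> K'"
      by (metis all_not_in_conv card.empty)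
    then have e: "(`) \<psi> ` edges K' = edges K" by (simp add: onto_def)
    moreover have "\<psi> ` verts K' = verts K"
      using e wf_Union_edges[OF K(1)] wf_Union_edges[OF K(2)] by (metis image_Union)
    moreover have "lab K (\<psi> v) = Some n" if "lab K' v = Some n" for v n
    proof -
      have "n \<in> ran (lab K)" using that ran'(1) by (simp add: ranI)
      then show ?thesis using \<psi> that lab\<phi> by (simp add: onto_def hom_ext_def)
    qed
    ultimately show ?thesis by blast
  qed
  have "\<exists>\<psi>. \<psi> ` verts H = verts G \<and> (`) \<psi> ` edges H = edges G \<and>
      (\<forall>v n. lab H v = Some n \<longrightarrow> lab G (\<psi> v) = Some n)"
    by (rule ex[OF wf B(1) ran refl], rule onto_eq)
  then obtain \<psi> where \<psi>: "\<psi> ` verts H = verts G" "(`) \<psi> ` edges H = edges G"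
    "\<forall>v n. lab H v = Some n \<longrightarrow> lab G (\<psi> v) = Some n"
    by (elim exE conjE) (rule that)
  have "\<exists>\<psi>. \<psi> ` verts G = verts H \<and> (`) \<psi> ` edges G = edges H \<and>
      (\<forall>v n. lab G v = Some n \<longrightarrow> lab H (\<psi> v) = Some n)"
    by (rule ex[OF wf(2,1) B(2) ran[symmetric] ran[symmetric]], rule onto_eq[symmetric])
  then obtain \<psi>' where "\<psi>' ` verts G = verts H" by (elim exE conjE) (rule that)
  then have "card (verts H) \<le> card (verts G)"
    by (metis card_image_le wf_finite_verts wf(1))
  moreover have "card (verts G) \<le> card (verts H)"
    by (metis card_image_le wf_finite_verts wf(2) \<psi>(1))
  ultimately have inj: "inj_on \<psi> (verts H)"
    using \<psi>(1) wf_finite_verts[OF wf(2)] by (simp add: eq_card_imp_inj_on)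
  \<comment> \<open>Labels are preserved forwards by \<open>\<psi>\<close>. Backwards, a label of
    the image also occurs in \<open>H\<close>, and injectivity puts it on the same vertex.\<close>
  have "lab G (\<psi> v) = lab H v" if v: "v \<in> verts H" for v
  proof (cases "lab G (\<psi> v)")
    case None
    then show ?thesis using \<psi>(3)[rule_format, of v] by (cases "lab H v") auto
  next
    case (Some n)
    then have "n \<in> ran (lab H)" using ran by (metis ranI)
    then obtain w where w: "lab H w = Some n" by (auto simp: ran_def)
    then have "\<psi> w = \<psi> v" using \<psi>(3)[rule_format, OF w] Some wf_lab_inj[OF wf(1)] by blast
    then have "w = v" using inj v wf_labeled_vert[OF wf(2) w] by (auto dest: inj_onD)
    then show ?thesis using w Some by simp
  qed
  then show ?thesis
    unfolding iso_pregraph_def bij_betw_def using wf inj \<psi> by blast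
qed

text \<open>Equality case of Cauchy-Schwarz: the hypotheses bound both squared norms by the inner
  product, so the squared distance of the two count vectors vanishes and
  \<open>iso_of_hom_ext\<close> applies.\<close>

lemma iso_of_hom_total:
  assumes wf: "wf_pregraph G" "wf_pregraph H" and fin: "finite B"
    and B: "verts G \<subseteq> B" "verts H \<subseteq> B" and ran: "ran (lab G) = ran (lab H)"
    and le: "hom_total B (glue_pregraph G G) \<le> hom_total B (glue_pregraph G H)"
      "hom_total B (glue_pregraph H H) \<le> hom_total B (glue_pregraph G H)"
  shows "iso_pregraph H G"
proof (rule iso_of_hom_ext[OF wf fin B ran])
  let ?S = "ran (lab G)"
  define X where "X = Pow (Pow B) \<times> (?S \<rightarrow>\<^sub>E B)"
  define f where "f K = (\<lambda>(R, \<phi>). real (card (hom_ext B R \<phi> K)))" for K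
  have "finite ?S"
  proof -
    have "?S \<subseteq> (\<lambda>v. the (lab G v)) ` verts G"
      unfolding ran_def using wf(1) wf_labeled_vert by force
    then show ?thesis using wf(1) by (meson finite_imageI finite_subset wf_finite_verts)
  qed
  then have finX: "finite X" unfolding X_def using fin by (auto intro!: finite_PiE)
  have tot: "real (hom_total B (glue_pregraph K L)) = (\<Sum>x\<in>X. f K x * f L x)"
    if "wf_pregraph K" "wf_pregraph L" "ran (lab K) = ?S" "ran (lab L) = ?S" for K L
    unfolding hom_total_def X_def f_def
    by (simp add: card_hom_set_glue[OF that(1,2) fin that(3,4)] sum.cartesian_product case_prod_unfold)
  have "(\<Sum>x\<in>X. (f G x - f H x)\<^sup>2) = (\<Sum>x\<in>X. f G x * f G x + f H x * f H x - 2 * (f G x * f H x))"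
    by (rule sum.cong) (simp_all add: power2_eq_square algebra_simps)
  also have "\<dots> = (\<Sum>x\<in>X. f G x * f G x) + (\<Sum>x\<in>X. f H x * f H x) - 2 * (\<Sum>x\<in>X. f G x * f H x)"
    by (simp only: sum.distrib sum_subtractf sum_distrib_left)
  also have "\<dots> \<le> 0"
    using le[THEN of_nat_mono[where 'a = real]] 
      tot[OF wf(1,1) refl refl] tot[OF wf refl ran[symmetric]] tot[OF wf(2,2) ran[symmetric] ran[symmetric]]
    by linarith
  finally have "(\<Sum>x\<in>X. (f G x - f H x)\<^sup>2) = 0"
    by (meson antisym sum_nonneg zero_le_power2)
  then have "\<forall>x\<in>X. f G x = f H x"
    using finX by (simp add: sum_nonneg_eq_0_iff)
  then show "card (hom_ext B R \<phi> G) = card (hom_ext B R \<phi> H)"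
    if "R \<subseteq> Pow B" "\<phi> \<in> ?S \<rightarrow>\<^sub>E B" for R \<phi>
    using that by (auto simp: X_def f_def)
qed

section \<open>Invariance of the counts under isomorphism\<close>

lemma hom_total_iso:
  assumes "iso_pregraph G H" shows "hom_total B G = hom_total B H"
proof -
  have le: "card (hom_set B R H) = card (hom_set B R G)" if iso: "iso_pregraph G H" for G H R
  proof -
    obtain f where wf: "wf_pregraph G" "wf_pregraph H" and f: "bij_betw f (verts G) (verts H)"
      and E: "(`) f ` edges G = edges H"
      using iso unfolding iso_pregraph_def by blast
    define f' where "f' = the_inv_into (verts G) f"
    have f'f: "f' (f v) = v" if "v \<in> verts G" for v
      using f that by (simp add: f'_def bij_betw_def the_inv_into_f_f)
    have ff': "f (f' v) = v" "f' v \<in> verts G" if "v \<in> verts H" for v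
      using f that f'f unfolding bij_betw_def by (metis imageE)+
    have fV: "f v \<in> verts H" if "v \<in> verts G" for v using f that by (auto simp: bij_betw_def)
    have img: "restrict (\<psi> \<circ> f) (verts G) ` e = \<psi> ` f ` e" if "e \<in> edges G" for \<psi> :: "nat \<Rightarrow> nat" and e
      using wf_pregraph_edgeD[OF wf(1) that] by (force simp: image_image)
    have img': "restrict (\<psi> \<circ> f') (verts H) ` f ` e = \<psi> ` e" if "e \<in> edges G" for \<psi> :: "nat \<Rightarrow> nat" and e
      using wf_pregraph_edgeD[OF wf(1) that] f'f fV unfolding image_image
      by (intro image_cong refl) auto
    have "bij_betw (\<lambda>\<psi>. restrict (\<psi> \<circ> f) (verts G)) (hom_set B R H) (hom_set B R G)"
    proof (rule bij_betw_byWitness[where f' = "\<lambda>\<psi>. restrict (\<psi> \<circ> f') (verts H)"])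
      show "\<forall>\<psi>\<in>hom_set B R H. restrict (restrict (\<psi> \<circ> f) (verts G) \<circ> f') (verts H) = \<psi>"
      proof (intro ballI ext)
        fix \<psi> x assume "\<psi> \<in> hom_set B R H"
        then have "\<psi> x = undefined" if "x \<notin> verts H"
          using that by (auto simp: hom_set_def intro: PiE_arb)
        then show "restrict (restrict (\<psi> \<circ> f) (verts G) \<circ> f') (verts H) x = \<psi> x"
          using ff' by (cases "x \<in> verts H") simp_all
      qed
      show "\<forall>\<psi>\<in>hom_set B R G. restrict (restrict (\<psi> \<circ> f') (verts H) \<circ> f) (verts G) = \<psi>"
      proof (intro ballI ext)
        fix \<psi> x assume "\<psi> \<in> hom_set B R G"
        then have "\<psi> x = undefined" if "x \<notin> verts G"
          using that by (auto simp: hom_set_def intro: PiE_arb)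
        then show "restrict (restrict (\<psi> \<circ> f') (verts H) \<circ> f) (verts G) x = \<psi> x"
          using f'f fV by (cases "x \<in> verts G") simp_all
      qed
      show "(\<lambda>\<psi>. restrict (\<psi> \<circ> f) (verts G)) ` hom_set B R H \<subseteq> hom_set B R G"
      proof (rule image_subsetI)
        fix \<psi> assume "\<psi> \<in> hom_set B R H"
        then have \<psi>: "\<psi> \<in> verts H \<rightarrow>\<^sub>E B" "\<forall>e\<in>edges G. \<psi> ` f ` e \<in> R"
          unfolding hom_set_def E[symmetric] by auto
        have "restrict (\<psi> \<circ> f) (verts G) \<in> verts G \<rightarrow>\<^sub>E B"
          using \<psi>(1) fV by auto
        then show "restrict (\<psi> \<circ> f) (verts G) \<in> hom_set B R G"
          using \<psi>(2) img unfolding hom_set_def E[symmetric] by (simp del: restrict_apply)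
      qed
      show "(\<lambda>\<psi>. restrict (\<psi> \<circ> f') (verts H)) ` hom_set B R G \<subseteq> hom_set B R H"
      proof (rule image_subsetI)
        fix \<psi> assume "\<psi> \<in> hom_set B R G"
        then have \<psi>: "\<psi> \<in> verts G \<rightarrow>\<^sub>E B" "\<forall>e\<in>edges G. \<psi> ` e \<in> R"
          unfolding hom_set_def E[symmetric] by auto
        have "restrict (\<psi> \<circ> f') (verts H) \<in> verts H \<rightarrow>\<^sub>E B"
          using \<psi>(1) ff' by auto
        then show "restrict (\<psi> \<circ> f') (verts H) \<in> hom_set B R H"
          using \<psi>(2) img' unfolding hom_set_def E[symmetric] by (simp del: restrict_apply)
      qed
    qed
    then show ?thesis by (rule bij_betw_same_card)
  qed
  show ?thesis unfolding hom_total_def using le[OF assms] by simp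
qed

lemma card_edges_iso:
  assumes "iso_pregraph G H" shows "card (edges G) = card (edges H)"
proof -
  obtain f where f: "bij_betw f (verts G) (verts H)" "(`) f ` edges G = edges H"
    and wf: "wf_pregraph G"
    using assms unfolding iso_pregraph_def by blast
  then have "inj_on f (\<Union> (edges G))" by (simp add: wf_Union_edges bij_betw_def)
  then have "inj_on ((`) f) (edges G)" by (rule inj_on_image)
  then show ?thesis using f(2) card_image by metis
qed

section \<open>The odd path as a square\<close>

text \<open>An injective walk along a path cannot turn back, so its first step fixes the direction;
  the bounds then leave only the identity and the reversal.\<close>

lemma path_automorphism:
  fixes p :: "nat \<Rightarrow> nat"
  assumes inj: "inj_on p {..k}" and le: "\<And>i. i \<le> k \<Longrightarrow> p i \<le> k"
    and adj: "\<And>i. i < k \<Longrightarrow> p (Suc i) = Suc (p i) \<or> p i = Suc (p (Suc i))"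
  shows "(\<forall>i\<le>k. p i = i) \<or> (\<forall>i\<le>k. p i = k - i)"
proof -
  \<comment> \<open>A turn at \<open>Suc i\<close> would give
    \<open>p (Suc (Suc i)) = p i\<close>.\<close>
  have 3: "p (Suc (Suc i)) = Suc (p (Suc i)) \<longleftrightarrow> p (Suc i) = Suc (p i)" if "Suc i < k" for i
  proof -
    have "p (Suc (Suc i)) \<noteq> p i" using that inj_onD[OF inj, of "Suc (Suc i)" i] by auto
    then show ?thesis using adj[of i] adj[of "Suc i"] that by presburger
  qed
  show ?thesis
  proof (cases "k = 0 \<or> p 1 = Suc (p 0)")
    case True
    have "p i = p 0 + i \<and> (i < k \<longrightarrow> p (Suc i) = Suc (p i))" if "i \<le> k" for i
      using that
    proof (induction i)
      case 0
      then show ?case using True by auto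
    next
      case (Suc i)
      then have "p (Suc i) = Suc (p i)" "p i = p 0 + i" by simp_all
      then show ?case using 3[of i] by simp
    qed
    then have "p i = p 0 + i" if "i \<le> k" for i using that by blast
    then have *: "\<forall>i\<le>k. p i = p 0 + i" by blast
    then have "p k = p 0 + k" by blast
    then have "p 0 = 0" using le[of k] by linarith
    then have "\<forall>i\<le>k. p i = i" using * by (metis add_0)
    then show ?thesis by blast
  next
    case False
    have "p 0 = p i + i \<and> (i < k \<longrightarrow> p i = Suc (p (Suc i)))" if "i \<le> k" for i
      using that
    proof (induction i)
      case 0
      then show ?case using False adj[of 0] by auto
    next
      case (Suc i)
      then have "p i = Suc (p (Suc i))" "p 0 = p i + i" by simp_all
      then show ?case using 3[of i] adj[of "Suc i"] by auto
    qed
    then have *: "p 0 = p i + i" if "i \<le> k" for i using that by blast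
    have "p 0 = k" using *[of k] le[of 0] by simp
    then have "\<forall>i\<le>k. p i = k - i" using * by (metis add_diff_cancel_right')
    then show ?thesis by blast
  qed
qed

text \<open>The exchange of the two copies of \<open>H\<close> is an involution of the square that
  fixes exactly the labeled vertices; transported to the path it becomes the map
  \<open>p\<close>.\<close>

lemma labeled_of_odd_path_square:
  assumes wf: "wf_pregraph H" and k: "odd k"
    and iso: "iso_pregraph (unlabel_pregraph (glue_pregraph H H)) (path_pregraph k)"
  shows "verts H \<subseteq> dom (lab H)"
proof -
  let ?K = "glue_pregraph H H" and ?g = "glue_vertex 1 H" and ?h = "glue_vertex 2 H"
  \<comment> \<open>Codes with first component 0 belong to labels and stay; \<open>3 - i\<close>
    interchanges the copy indices 1 and 2.\<close>
  define s where "s w = (case prod_decode w of (i, n) \<Rightarrow>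
      if i = 0 then w else prod_encode (3 - i, n))" for w
  have s: "s (?g v) = ?h v" "s (?h v) = ?g v" for v
    by (auto simp: s_def glue_vertex_def split: option.splits)
  have ss: "s w \<in> verts ?K" "s (s w) = w" if "w \<in> verts ?K" for w
    using that by (auto simp: verts_glue s simp del: One_nat_def)
  have sE: "s ` e \<in> edges ?K" if "e \<in> edges ?K" for e
    using that unfolding edges_glue by (auto simp: image_image s simp del: One_nat_def)
  obtain f where f: "bij_betw f (verts ?K) (verts (path_pregraph k))"
    and fE: "(`) f ` edges ?K = edges (path_pregraph k)"
    using iso unfolding iso_pregraph_def by (auto simp: unlabel_pregraph_def)
  have V: "verts (path_pregraph k) = {..k}" and E: "edges (path_pregraph k) = {{i, Suc i} | i. i < k}"
    using k by (auto simp: path_pregraph_def elim: oddE)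
  define f' where "f' = the_inv_into (verts ?K) f"
  have f'f: "f' (f w) = w" if "w \<in> verts ?K" for w
    using f that by (simp add: f'_def bij_betw_def the_inv_into_f_f)
  have ff': "f (f' i) = i" "f' i \<in> verts ?K" if "i \<le> k" for i
  proof -
    have "i \<in> f ` verts ?K" using bij_betw_imp_surj_on[OF f] V that by simp
    then obtain w where "w \<in> verts ?K" "i = f w" by blast
    then show "f (f' i) = i" "f' i \<in> verts ?K" using f'f by auto
  qed
  have fle: "f w \<le> k" if "w \<in> verts ?K" for w using f that by (auto simp: bij_betw_def V)
  have finj: "w = w'" if "f w = f w'" "w \<in> verts ?K" "w' \<in> verts ?K" for w w'
    using f that by (auto simp: bij_betw_def dest: inj_onD)
  have edge: "\<exists>e\<in>edges ?K. e = {f' i, f' (Suc i)}" if "i < k" for i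
  proof -
    have "{i, Suc i} \<in> (`) f ` edges ?K" using that unfolding fE E by blast
    then obtain e where e: "e \<in> edges ?K" "f ` e = {i, Suc i}" by blast
    have "e = f' ` f ` e"
      using wf_pregraph_edgeD[OF wf_glue_pregraph[OF wf wf] e(1)] f'f by (force simp: image_image)
    then show ?thesis using e by auto
  qed
  define p where "p i = f (s (f' i))" for i
  have "(\<forall>i\<le>k. p i = i) \<or> (\<forall>i\<le>k. p i = k - i)"
  proof (rule path_automorphism)
    show "inj_on p {..k}"
    proof (rule inj_onI)
      fix i j assume ij: "i \<in> {..k}" "j \<in> {..k}" "p i = p j"
      then have "s (f' i) = s (f' j)" using finj ss ff' by (auto simp: p_def)
      then show "i = j" using ss ff' ij by (metis atMost_iff)
    qed
    show "p i \<le> k" if "i \<le> k" for i using fle ss ff' that by (simp add: p_def)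
    show "p (Suc i) = Suc (p i) \<or> p i = Suc (p (Suc i))" if "i < k" for i
    proof -
      have "{f' i, f' (Suc i)} \<in> edges ?K" using edge[OF that] by blast
      then have "f ` s ` {f' i, f' (Suc i)} \<in> edges (path_pregraph k)"
        using sE fE by blast
      then show ?thesis unfolding E p_def by (auto simp: doubleton_eq_iff)
    qed
  qed
  then show ?thesis
  proof
    assume id: "\<forall>i\<le>k. p i = i"
    show ?thesis
    proof
      fix v assume v: "v \<in> verts H"
      then have w: "?g v \<in> verts ?K" "?h v \<in> verts ?K" by (auto simp: verts_glue)
      \<comment> \<open>A vertex that coincides with its mirror copy must be labeled.\<close>
      have "f (?h v) = f (?g v)"
        using id fle[OF w(1)] f'f[OF w(1)] s(1)[of v] by (metis p_def)
      then have "?h v = ?g v" using w finj by blast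
      then show "v \<in> dom (lab H)" using glue_vertex_12[of H v H v] by auto
    qed
  next
    assume rev: "\<forall>i\<le>k. p i = k - i"
    \<comment> \<open>The reversal interchanges \<open>m\<close> and \<open>Suc m\<close>, the ends
      of the middle edge.\<close>
    obtain m where m: "k = 2 * m + 1" using k by (elim oddE)
    have e: "{f' m, f' (Suc m)} \<in> edges ?K" using edge[of m] m by auto
    have "f (s (f' m)) = f (f' (Suc m))"
      using rev[rule_format, of m] ff'(1)[of "Suc m"] m by (simp add: p_def)
    then have sm: "s (f' m) = f' (Suc m)" using finj ss ff' m by auto
    have ne: "f' m \<noteq> f' (Suc m)" using ff'(1)[of m] ff'(1)[of "Suc m"] m by auto
    \<comment> \<open>The middle edge lies in one copy, yet the exchange maps one of its ends to the
      other. This identifies vertices of different copies, so that end is labeled, hence fixed,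
      contradicting \<open>ne\<close>.\<close>
    have lab: "?g v = ?h v" if "?g v = ?h w \<or> ?h v = ?g w" for v w
      using that glue_vertex_12[of H v H w] glue_vertex_12[of H w H v] by (auto simp: glue_vertex_Some)
    from e consider a where "a \<in> edges H" "{f' m, f' (Suc m)} = ?g ` a"
      | a where "a \<in> edges H" "{f' m, f' (Suc m)} = ?h ` a"
      unfolding edges_glue by blast
    then show ?thesis
    proof cases
      case 1
      then obtain x y where "f' m = ?g x" "f' (Suc m) = ?g y" by blast
      then show ?thesis using sm ne lab[of x y] s by metis
    next
      case 2
      then obtain x y where "f' m = ?h x" "f' (Suc m) = ?h y" by blast
      then show ?thesis using sm ne lab[of x y] s by metis
    qed
  qed
qed

lemma card_edges_path: "card (edges (path_pregraph k)) = k"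
proof -
  have P: "edges (path_pregraph k) = (\<lambda>i. {i, Suc i}) ` {..<k}"
    by (auto simp: path_pregraph_def)
  have "inj (\<lambda>i::nat. {i, Suc i})" by (rule injI) (auto simp: doubleton_eq_iff)
  then show "card (edges (path_pregraph k)) = k"
    unfolding P by (simp add: card_image inj_on_subset)
qed

text \<open>Full labeling makes the square of \<open>H\<close> a renamed \<open>H\<close>, so
  \<open>H\<close> already has \<open>k\<close> edges. A product with at most \<open>k\<close> edges
  then adds no edge, and no vertex either, since none is isolated.\<close>

lemma odd_path_square_absorbs:
  assumes wf: "wf_pregraph H" "wf_pregraph L" and k: "odd k"
    and iso: "iso_pregraph (unlabel_pregraph (glue_pregraph H H)) (path_pregraph k)"
    and le: "card (edges (glue_pregraph H L)) \<le> k"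
  shows "unlabel_pregraph (glue_pregraph H L) = unlabel_pregraph (glue_pregraph H H)"
proof -
  have labeled: "glue_vertex 2 H v = glue_vertex 1 H v" if "v \<in> verts H" for v
    using labeled_of_odd_path_square[OF wf(1) k iso] that by (auto simp: glue_vertex_Some)
  have "glue_vertex 2 H ` e = glue_vertex 1 H ` e" if "e \<in> edges H" for e
    using wf_pregraph_edgeD[OF wf(1) that] labeled by (intro image_cong) auto
  then have E: "edges (glue_pregraph H H) = (`) (glue_vertex 1 H) ` edges H"
    unfolding edges_glue by auto
  have "card (edges (path_pregraph k)) = k" by (rule card_edges_path)
  moreover have "card (edges (path_pregraph k)) = card (edges (glue_pregraph H H))"
    using card_edges_iso[OF iso] by (simp add: unlabel_pregraph_def)
  ultimately have "card (edges (glue_pregraph H L)) \<le> card (edges (glue_pregraph H H))"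
    using le by simp
  moreover have "edges (glue_pregraph H H) \<subseteq> edges (glue_pregraph H L)"
    unfolding E edges_glue[of H L] by blast
  ultimately have eq: "edges (glue_pregraph H H) = edges (glue_pregraph H L)"
    using wf wf_finite_edges[OF wf_glue_pregraph[OF wf]] by (intro card_seteq)
  moreover have "verts (glue_pregraph H H) = verts (glue_pregraph H L)"
    using eq wf wf_Union_edges wf_glue_pregraph by metis
  ultimately show ?thesis by (simp add: unlabel_pregraph_def)
qed

section \<open>Invariants of isomorphism classes\<close>

lemma card_verts_iso:
  assumes "iso_pregraph G H" shows "card (verts G) = card (verts H)"
  using assms bij_betw_same_card unfolding iso_pregraph_def by metis

lift_definition num_edges :: "plgraph \<Rightarrow> nat" is "\<lambda>G. card (edges G)"
  by (rule card_edges_iso)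

lift_definition num_verts :: "plgraph \<Rightarrow> nat" is "\<lambda>G. card (verts G)"
  by (rule card_verts_iso)

lift_definition hom_count :: "nat set \<Rightarrow> plgraph \<Rightarrow> nat" is hom_total
  by (rule hom_total_iso)

lemma num_edges_unlabel [simp]: "num_edges (unlabel G) = num_edges G"
  by transfer (simp add: unlabel_pregraph_def)

lemma num_verts_unlabel [simp]: "num_verts (unlabel G) = num_verts G"
  by transfer (simp add: unlabel_pregraph_def)

lemma hom_count_unlabel [simp]: "hom_count B (unlabel G) = hom_count B G"
  by transfer (simp add: unlabel_pregraph_def hom_total_def hom_set_def)

lemma num_edges_square_le: "num_edges (G + G) + num_edges (H + H) \<le> 2 * num_edges (G + H)"
  by transfer (simp add: card_edges_glue iso_pregraph_def)

lemma num_verts_square_le: "num_verts (G + G) + num_verts (H + H) \<le> 2 * num_verts (G + H)"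
  by transfer (simp add: card_verts_glue iso_pregraph_def)

lemma plgraph_representative: "\<exists>G'. wf_pregraph G' \<and> G = abs_plgraph G'"
  by (metis Quotient_plgraph Quotient_abs_rep Quotient_rep_reflp iso_pregraph_def)

text \<open>The equality case for vertices gives equal label sets, and that for homomorphisms gives
  an isomorphism. As \<open>X\<close> is finite, one \<open>B\<close> containing the vertices of
  chosen representatives serves every pair.\<close>

lemma hom_count_separates:
  assumes "finite X"
  shows "\<exists>B. \<forall>G\<in>X. \<forall>H\<in>X. num_verts (G + G) + num_verts (H + H) = 2 * num_verts (G + H) \<longrightarrow>
    hom_count B (G + G) \<le> hom_count B (G + H) \<longrightarrow> hom_count B (H + H) \<le> hom_count B (G + H) \<longrightarrow> G = H"
proof -
  obtain r where r: "\<And>G. wf_pregraph (r G)" "\<And>G. abs_plgraph (r G) = G"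
    using plgraph_representative by metis
  have add: "G + H = abs_plgraph (glue_pregraph (r G) (r H))" for G H
    using plus_plgraph.abs_eq[of "r G" "r H"] r by (simp add: iso_pregraph_refl)
  define B where "B = (\<Union>G\<in>X. verts (r G))"
  have fin: "finite B" using assms r(1) by (simp add: B_def wf_finite_verts)
  have "G = H" if X: "G \<in> X" "H \<in> X"
    and v: "num_verts (G + G) + num_verts (H + H) = 2 * num_verts (G + H)"
    and h: "hom_count B (G + G) \<le> hom_count B (G + H)" "hom_count B (H + H) \<le> hom_count B (G + H)" for G H
  proof -
    have nv: "num_verts (K + L) = card (verts (glue_pregraph (r K) (r L)))"
      and nh: "hom_count B (K + L) = hom_total B (glue_pregraph (r K) (r L))" for K L
      unfolding add by (simp_all add: num_verts.abs_eq hom_count.abs_eq iso_pregraph_refl wf_glue_pregraph r)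
    have "ran (lab (r G)) = ran (lab (r H))"
      using card_verts_glue(2)[OF r(1) r(1), of G H] v unfolding nv by simp
    then have "iso_pregraph (r H) (r G)"
      using iso_of_hom_total[OF r(1) r(1) fin, of G H] h X unfolding nh by (auto simp: B_def)
    then show "G = H" by (metis Quotient_plgraph Quotient_rel_abs r(2))
  qed
  then show ?thesis by blast
qed

section \<open>Edge and vertex counts of products\<close>

lemma num_edges_le_add: "num_edges G \<le> num_edges (G + H)"
proof transfer
  fix G H assume "iso_pregraph G G" "iso_pregraph H H"
  then have wf: "wf_pregraph G" "wf_pregraph H" by (auto simp: iso_pregraph_def)
  have "card (edges G) = card ((`) (glue_vertex 1 G) ` edges G)"
    using wf by (simp add: card_glue_edge_image)
  also have "\<dots> \<le> card (edges (glue_pregraph G H))"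
    using wf_finite_edges[OF wf_glue_pregraph[OF wf]] by (intro card_mono) (auto simp: edges_glue)
  finally show "card (edges G) \<le> card (edges (glue_pregraph G H))" .
qed

lemma num_edges_eq_0: "num_edges G = 0 \<Longrightarrow> G = 0"
proof transfer
  fix G assume "iso_pregraph G G" "card (edges G) = 0"
  then have wf: "wf_pregraph G" and "edges G = {}"
    by (auto simp: iso_pregraph_def wf_finite_edges)
  then have "verts G = {}" using wf_Union_edges by fastforce
  moreover from this have "lab G = Map.empty" using wf by (simp add: wf_pregraph_def)
  ultimately have "G = empty_pregraph"
    using \<open>edges G = {}\<close> by (cases G) (simp add: empty_pregraph_def)
  then show "iso_pregraph G empty_pregraph" using wf iso_pregraph_refl by simp
qed

lemma num_edges_zero [simp]: "num_edges 0 = 0"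
  by transfer (simp add: empty_pregraph_def)

lemma num_verts_zero [simp]: "num_verts 0 = 0"
  by transfer (simp add: empty_pregraph_def)

lemma glue_unlabeled_disjoint:
  assumes "lab G = Map.empty"
  shows "glue_vertex 1 G ` X \<inter> glue_vertex 2 H ` Y = {}"
proof -
  have False if "glue_vertex 1 G v = glue_vertex 2 H w" for v w
    using glue_vertex_12[OF that] assms by simp
  then show ?thesis by blast
qed

lemma num_verts_add:
  assumes "unlabeled G" shows "num_verts (G + H) = num_verts G + num_verts H"
  using assms
proof transfer
  fix G H assume "iso_pregraph G G" "iso_pregraph H H" and lab: "lab G = Map.empty"
  then have wf: "wf_pregraph G" "wf_pregraph H" by (auto simp: iso_pregraph_def)
  show "card (verts (glue_pregraph G H)) = card (verts G) + card (verts H)"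
    unfolding verts_glue using wf lab
    by (subst card_Un_disjoint) (simp_all add: wf_finite_verts card_glue_vertex_image glue_unlabeled_disjoint del: One_nat_def)
qed

lemma num_edges_add:
  assumes "unlabeled G" shows "num_edges (G + H) = num_edges G + num_edges H"
  using assms
proof transfer
  fix G H assume "iso_pregraph G G" "iso_pregraph H H" and lab: "lab G = Map.empty"
  then have wf: "wf_pregraph G" "wf_pregraph H" by (auto simp: iso_pregraph_def)
  have "glue_vertex 1 G ` e \<noteq> glue_vertex 2 H ` f" if "e \<in> edges G" for e f
  proof -
    have "e \<noteq> {}" using wf_edge_pair[OF wf(1) that] by blast
    then show ?thesis using glue_unlabeled_disjoint[OF lab, of e H f] by blast
  qed
  then have "(`) (glue_vertex 1 G) ` edges G \<inter> (`) (glue_vertex 2 H) ` edges H = {}" by blast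
  then show "card (edges (glue_pregraph G H)) = card (edges G) + card (edges H)"
    unfolding edges_glue using wf
    by (subst card_Un_disjoint) (simp_all add: wf_finite_edges card_glue_edge_image del: One_nat_def)
qed

lemma unlabeled_add: "unlabeled G \<Longrightarrow> unlabeled H \<Longrightarrow> unlabeled (G + H)"
  by transfer (auto simp: glue_pregraph_def split: prod.splits)

lemma unlabeled_zero: "unlabeled 0"
  by transfer (simp add: empty_pregraph_def)

lemma edge_graph_invariants:
  "unlabeled edge_graph" "num_edges edge_graph = 1" "num_verts edge_graph = 2"
  by (transfer, simp add: edge_pregraph_def)+

lemma path_graph_invariants:
  assumes "k > 0"
  shows "unlabeled (path_graph k)" "num_edges (path_graph k) = k" "num_verts (path_graph k) = Suc k"
proof -
  show "unlabeled (path_graph k)" by transfer (simp add: path_pregraph_def)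
  show "num_verts (path_graph k) = Suc k" using assms by transfer (simp add: path_pregraph_def)
  show "num_edges (path_graph k) = k" by transfer (rule card_edges_path)
qed

text \<open>The vertex count \<open>2 * k\<close> is what later separates this graph from the path,
  which has \<open>k + 1\<close> vertices.\<close>

lemma gc_edge_power:
  "\<exists>F. gc edge_graph ^ k = gc F \<and> unlabeled F \<and> num_edges F = k \<and> num_verts F = 2 * k"
proof (induction k)
  case 0
  show ?case by (rule exI[of _ 0]) (simp add: gc_empty unlabeled_zero)
next
  case (Suc k)
  then obtain F where "gc edge_graph ^ k = gc F" "unlabeled F" "num_edges F = k" "num_verts F = 2 * k"
    by blast
  then show ?case
    by (intro exI[of _ "edge_graph + F"])
      (simp add: gc_mult unlabeled_add edge_graph_invariants num_edges_add num_verts_add)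
qed

lemma unlabel_add_eq_odd_path:
  assumes "odd k" "unlabel (H + H) = path_graph k" "num_edges (H + L) \<le> k"
  shows "unlabel (H + L) = path_graph k"
  using assms
proof transfer
  fix k H L
  assume "odd k" "iso_pregraph H H" "iso_pregraph L L" "card (edges (glue_pregraph H L)) \<le> k"
    and iso: "iso_pregraph (unlabel_pregraph (glue_pregraph H H)) (path_pregraph k)"
  then show "iso_pregraph (unlabel_pregraph (glue_pregraph H L)) (path_pregraph k)"
    using odd_path_square_absorbs[of H L k] by (simp add: iso_pregraph_def)
qed

section \<open>Coefficients of sums of squares\<close>

lemma poly_mapping_sum_singles:
  "x = (\<Sum>G\<in>Poly_Mapping.keys x. Poly_Mapping.single G (Poly_Mapping.lookup x G))"
proof (rule poly_mapping_eqI)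
  fix F
  show "Poly_Mapping.lookup x F =
      Poly_Mapping.lookup (\<Sum>G\<in>Poly_Mapping.keys x. Poly_Mapping.single G (Poly_Mapping.lookup x G)) F"
    by (cases "F \<in> Poly_Mapping.keys x")
      (simp_all add: lookup_sum lookup_single when_def in_keys_iff)
qed

lemma lookup_scaleR: "Poly_Mapping.lookup (r *\<^sub>R x) F = r * Poly_Mapping.lookup x F"
  for x :: graph_comb
  by (simp add: scaleR_poly_mapping_def)

lemma lookup_sum_list: "Poly_Mapping.lookup (sum_list xs) F = (\<Sum>x\<leftarrow>xs. Poly_Mapping.lookup x F)"
  by (induction xs) (simp_all add: lookup_add)

text \<open>Any finite superset \<open>S\<close> of the support is allowed, so that several
  combinations can be summed over one index set.\<close>

lemma lookup_unlabel_comb: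
  assumes "finite S" "Poly_Mapping.keys x \<subseteq> S"
  shows "Poly_Mapping.lookup (unlabel_comb x) F =
    (\<Sum>G\<in>S. Poly_Mapping.lookup x G * of_bool (unlabel G = F))"
proof -
  have "Poly_Mapping.lookup (unlabel_comb x) F =
      (\<Sum>G\<in>Poly_Mapping.keys x. Poly_Mapping.lookup x G * of_bool (unlabel G = F))"
    by (simp add: unlabel_comb_def lookup_sum lookup_scaleR gc_def lookup_single when_def of_bool_def)
  also have "\<dots> = (\<Sum>G\<in>S. Poly_Mapping.lookup x G * of_bool (unlabel G = F))"
    using assms by (intro sum.mono_neutral_left) (auto simp: in_keys_iff)
  finally show ?thesis .
qed

lemma unlabel_comb_sum:
  assumes "finite I"
  shows "unlabel_comb (\<Sum>i\<in>I. x i) = (\<Sum>i\<in>I. unlabel_comb (x i))"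
proof (rule poly_mapping_eqI)
  fix F
  define S where "S = Poly_Mapping.keys (\<Sum>i\<in>I. x i) \<union> (\<Union>i\<in>I. Poly_Mapping.keys (x i))"
  have S: "finite S" using assms by (simp add: S_def)
  have "Poly_Mapping.lookup (unlabel_comb (\<Sum>i\<in>I. x i)) F =
      (\<Sum>G\<in>S. \<Sum>i\<in>I. Poly_Mapping.lookup (x i) G * of_bool (unlabel G = F))"
    by (subst lookup_unlabel_comb[OF S]) (auto simp: S_def lookup_sum sum_distrib_right)
  also have "\<dots> = (\<Sum>i\<in>I. Poly_Mapping.lookup (unlabel_comb (x i)) F)"
    by (subst sum.swap, rule sum.cong[OF refl], subst lookup_unlabel_comb[OF S]) (auto simp: S_def)
  finally show "Poly_Mapping.lookup (unlabel_comb (\<Sum>i\<in>I. x i)) F =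
      Poly_Mapping.lookup (\<Sum>i\<in>I. unlabel_comb (x i)) F"
    by (simp add: lookup_sum)
qed

lemma lookup_unlabel_comb_mult:
  "Poly_Mapping.lookup (unlabel_comb (a * b)) F =
    (\<Sum>G\<in>Poly_Mapping.keys a. \<Sum>H\<in>Poly_Mapping.keys b.
      Poly_Mapping.lookup a G * Poly_Mapping.lookup b H * of_bool (unlabel (G + H) = F))"
proof -
  have "a * b = (\<Sum>G\<in>Poly_Mapping.keys a. \<Sum>H\<in>Poly_Mapping.keys b.
      Poly_Mapping.single (G + H) (Poly_Mapping.lookup a G * Poly_Mapping.lookup b H))"
    by (subst poly_mapping_sum_singles[of a], subst poly_mapping_sum_singles[of b])
      (simp add: sum_product mult_single)
  moreover have "Poly_Mapping.lookup (unlabel_comb (Poly_Mapping.single K r)) F = r * of_bool (unlabel K = F)"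
    for K r
    by (subst lookup_unlabel_comb[of "{K}"]) auto
  ultimately show ?thesis by (simp add: unlabel_comb_sum lookup_sum)
qed

text \<open>Edge numbers add when one factor is unlabeled, so up to \<open>num_edges P\<close> edges
  only the constant term of \<open>x\<close> contributes.\<close>

lemma lookup_single_mult_unlabeled:
  assumes x: "x \<in> unlabeled_combs" and P: "unlabeled P" and F: "num_edges F \<le> num_edges P"
  shows "Poly_Mapping.lookup (Poly_Mapping.single P c * x) F =
    c * of_bool (F = P) * Poly_Mapping.lookup x 0"
proof -
  have "Poly_Mapping.single P c * x =
      (\<Sum>K\<in>Poly_Mapping.keys x. Poly_Mapping.single (P + K) (c * Poly_Mapping.lookup x K))"
    by (subst poly_mapping_sum_singles[of x]) (simp add: sum_distrib_left mult_single)
  moreover have "Poly_Mapping.lookup (Poly_Mapping.single (P + K) r) F = r * of_bool (P + K = F)" for K and r :: real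
    by (simp add: lookup_single when_def)
  ultimately have "Poly_Mapping.lookup (Poly_Mapping.single P c * x) F =
      (\<Sum>K\<in>Poly_Mapping.keys x. c * Poly_Mapping.lookup x K * of_bool (P + K = F))"
    by (simp add: lookup_sum)
  also have "\<dots> = (\<Sum>K\<in>Poly_Mapping.keys x. if K = 0 then c * of_bool (F = P) * Poly_Mapping.lookup x 0 else 0)"
  proof (rule sum.cong[OF refl])
    fix K assume "K \<in> Poly_Mapping.keys x"
    have "K = 0" if "P + K = F"
      using num_edges_add[OF P, of K] F num_edges_eq_0[of K] that by simp
    then show "c * Poly_Mapping.lookup x K * of_bool (P + K = F) =
        (if K = 0 then c * of_bool (F = P) * Poly_Mapping.lookup x 0 else 0)"
      by auto
  qed
  also have "\<dots> = c * of_bool (F = P) * Poly_Mapping.lookup x 0"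
    by (simp add: in_keys_iff)
  finally show ?thesis .
qed

section \<open>Signs of the low-degree coefficients\<close>

lemma sos_lookup_zero_nonneg:
  assumes "sos g" shows "Poly_Mapping.lookup g 0 \<ge> 0"
proof -
  obtain as where g: "g = (\<Sum>a\<leftarrow>as. unlabel_comb (a\<^sup>2))" using assms by (auto simp: sos_def)
  have "Poly_Mapping.lookup (unlabel_comb (a\<^sup>2)) 0 \<ge> 0" for a
  proof -
    \<comment> \<open>Only the empty graph times itself gives the empty graph, so the constant term
      is a square.\<close>
    have zero: "G = 0 \<and> H = 0" if "unlabel (G + H) = 0" for G H
    proof -
      have "num_edges (unlabel (G + H)) = 0" using that by simp
      then have "num_edges G = 0" "num_edges H = 0"
        using num_edges_le_add[of G H] num_edges_le_add[of H G] by (simp_all add: add.commute)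
      then show ?thesis using num_edges_eq_0 by blast
    qed
    have "Poly_Mapping.lookup a G * Poly_Mapping.lookup a H * of_bool (unlabel (G + H) = 0) \<ge> 0" for G H
      using zero[of G H] by (cases "unlabel (G + H) = 0") auto
    then show ?thesis unfolding power2_eq_square lookup_unlabel_comb_mult by (intro sum_nonneg) auto
  qed
  then show ?thesis unfolding g lookup_sum_list by (intro sum_list_nonneg) auto
qed

text \<open>Minimality of the vertex count forces equality in \<open>num_verts_square_le\<close> for
  every product that looks like \<open>G + G\<close>. Maximality of the homomorphism count among the
  minimizers then bounds both squares by the mixed count, as \<open>hom_count_separates\<close>
  demands.\<close>

lemma exists_diagonal_class:
  fixes X :: "plgraph set"
  assumes X: "finite X" "X \<noteq> {}"
  shows "\<exists>G\<in>X. \<forall>H\<in>X. \<forall>L\<in>X. unlabel (H + L) = unlabel (G + G) \<longrightarrow> H = L"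
proof -
  obtain B where B: "\<And>G H. G \<in> X \<Longrightarrow> H \<in> X \<Longrightarrow>
      num_verts (G + G) + num_verts (H + H) = 2 * num_verts (G + H) \<Longrightarrow>
      hom_count B (G + G) \<le> hom_count B (G + H) \<Longrightarrow> hom_count B (H + H) \<le> hom_count B (G + H) \<Longrightarrow> G = H"
    using hom_count_separates[OF X(1)] by blast
  define v where "v = Min ((\<lambda>H. num_verts (H + H)) ` X)"
  have v: "v \<le> num_verts (H + H)" if "H \<in> X" for H using X that by (simp add: v_def)
  define Y where "Y = {H \<in> X. num_verts (H + H) = v}"
  have "v \<in> (\<lambda>H. num_verts (H + H)) ` X" unfolding v_def using X by (intro Min_in) auto
  then have Y: "finite Y" "Y \<noteq> {}" using X by (auto simp: Y_def)
  define n where "n = Max ((\<lambda>H. hom_count B (H + H)) ` Y)"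
  have n: "hom_count B (H + H) \<le> n" if "H \<in> Y" for H using Y that by (simp add: n_def)
  have "n \<in> (\<lambda>H. hom_count B (H + H)) ` Y" unfolding n_def using Y by (intro Max_in) auto
  then obtain G where G: "G \<in> Y" "hom_count B (G + G) = n" by auto
  have "H = L" if HL: "H \<in> X" "L \<in> X" "unlabel (H + L) = unlabel (G + G)" for H L
  proof -
    have nv: "num_verts (H + L) = v" and nh: "hom_count B (H + L) = n"
      using HL(3) G by (metis (mono_tags, lifting) num_verts_unlabel hom_count_unlabel Y_def mem_Collect_eq)+
    then have "num_verts (H + H) = v" "num_verts (L + L) = v"
      using num_verts_square_le[of H L] v[OF HL(1)] v[OF HL(2)] by linarith+
    then show "H = L" using B[OF HL(1,2)] nv nh n HL by (auto simp: Y_def)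
  qed
  then show ?thesis using G by (auto simp: Y_def)
qed

text \<open>A nonempty \<open>X\<close> would produce a positive coefficient away from the path,
  against \<open>le\<close>. Once \<open>X\<close> is empty, the only squares with at most
  \<open>k\<close> edges are paths, and these cannot contribute to \<open>Q\<close>.\<close>

lemma sos_low_degree_coeff:
  assumes k: "odd k" and T: "sos T"
    and le: "\<And>F. num_edges F \<le> k \<Longrightarrow> F \<noteq> path_graph k \<Longrightarrow> Poly_Mapping.lookup T F \<le> 0"
    and Q: "num_edges Q \<le> k" "Q \<noteq> path_graph k"
  shows "Poly_Mapping.lookup T Q = 0"
proof -
  obtain as where T: "T = (\<Sum>a\<leftarrow>as. unlabel_comb (a\<^sup>2))" using T by (auto simp: sos_def)
  have coeff: "Poly_Mapping.lookup T F = (\<Sum>a\<leftarrow>as. \<Sum>G\<in>Poly_Mapping.keys a. \<Sum>H\<in>Poly_Mapping.keys a.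
      Poly_Mapping.lookup a G * Poly_Mapping.lookup a H * of_bool (unlabel (G + H) = F))" for F
    by (simp add: T lookup_sum_list power2_eq_square lookup_unlabel_comb_mult comp_def)
  define supp where "supp = (\<Union>a\<in>set as. Poly_Mapping.keys a)"
  define X where "X = {H \<in> supp. num_edges (H + H) \<le> k \<and> unlabel (H + H) \<noteq> path_graph k}"
  have "finite supp" by (simp add: supp_def)
  then have finX: "finite X" by (simp add: X_def)
  \<comment> \<open>By absorption, a product with at most \<open>k\<close> edges is the path as soon
    as one factor squares to the path.\<close>
  have not_path: "unlabel (H + H) \<noteq> path_graph k" "unlabel (L + L) \<noteq> path_graph k"
    if "unlabel (H + L) \<noteq> path_graph k" "num_edges (H + L) \<le> k" for H L
    using unlabel_add_eq_odd_path[OF k, of H L] unlabel_add_eq_odd_path[OF k, of L H] that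
    by (auto simp: add.commute)
  have "X = {}"
  proof (rule ccontr)
    assume "X \<noteq> {}"
    define m where "m = Min ((\<lambda>H. num_edges (H + H)) ` X)"
    have m: "m \<le> num_edges (H + H)" if "H \<in> X" for H using finX that by (simp add: m_def)
    have "m \<in> (\<lambda>H. num_edges (H + H)) ` X"
      unfolding m_def using finX \<open>X \<noteq> {}\<close> by (intro Min_in) auto
    define Y where "Y = {H \<in> X. num_edges (H + H) = m}"
    have Y: "finite Y" "Y \<noteq> {}" using finX \<open>m \<in> _\<close> by (auto simp: Y_def)
    obtain G where G: "G \<in> Y" and diag: "\<And>H L. H \<in> Y \<Longrightarrow> L \<in> Y \<Longrightarrow> unlabel (H + L) = unlabel (G + G) \<Longrightarrow> H = L"
      using exists_diagonal_class[OF Y] by blast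
    define F where "F = unlabel (G + G)"
    have F: "num_edges F = m" "m \<le> k" "F \<noteq> path_graph k"
      using G by (auto simp: F_def Y_def X_def)
    \<comment> \<open>\<open>diag\<close> concerns pairs in \<open>Y\<close> only, but any pair in
      the supports that produces \<open>F\<close> has both squares with exactly \<open>m\<close>
      edges and so lies in \<open>Y\<close>.\<close>
    have diagonal: "H = L" if HL: "H \<in> supp" "L \<in> supp" "unlabel (H + L) = F" for H L
    proof -
      have e: "num_edges (H + L) = m" using HL(3) F(1) by (metis num_edges_unlabel)
      have np: "unlabel (H + H) \<noteq> path_graph k" "unlabel (L + L) \<noteq> path_graph k"
        using not_path[of H L] HL(3) F e by auto
      have sum: "num_edges (H + H) + num_edges (L + L) \<le> 2 * m"
        using num_edges_square_le[of H L] e by simp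
      \<comment> \<open>Outside \<open>X\<close>, such a square has more than \<open>k\<close>
        edges, and \<open>m \<le> k\<close>.\<close>
      have ge: "m \<le> num_edges (K + K)" if "K \<in> supp" "unlabel (K + K) \<noteq> path_graph k" for K
        using m[of K] that F(2) by (cases "num_edges (K + K) \<le> k") (auto simp: X_def)
      have "num_edges (H + H) = m" "num_edges (L + L) = m"
        using sum ge[OF HL(1) np(1)] ge[OF HL(2) np(2)] by linarith+
      then have "H \<in> Y" "L \<in> Y" using HL np F(2) by (auto simp: Y_def X_def)
      then show "H = L" using diag HL(3) by (simp add: F_def)
    qed
    have supp: "H \<in> supp" if "a \<in> set as" "H \<in> Poly_Mapping.keys a" for a H
      using that by (auto simp: supp_def)
    have nonneg: "Poly_Mapping.lookup a H * Poly_Mapping.lookup a L * of_bool (unlabel (H + L) = F) \<ge> 0"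
      if "H \<in> supp" "L \<in> supp" for a :: graph_comb and H L
      using diagonal[OF that] by (cases "unlabel (H + L) = F") auto
    have inner: "(\<Sum>H\<in>Poly_Mapping.keys a. \<Sum>L\<in>Poly_Mapping.keys a.
        Poly_Mapping.lookup a H * Poly_Mapping.lookup a L * of_bool (unlabel (H + L) = F)) \<ge> 0"
      if "a \<in> set as" for a
      using nonneg[OF supp[OF that] supp[OF that]] by (intro sum_nonneg)
    obtain a where a: "a \<in> set as" "G \<in> Poly_Mapping.keys a"
      using G by (auto simp: Y_def X_def supp_def)
    \<comment> \<open>The coefficient of \<open>F\<close> dominates this single diagonal term, as
      all other contributions are nonnegative.\<close>
    have "0 < Poly_Mapping.lookup a G * Poly_Mapping.lookup a G * of_bool (unlabel (G + G) = F)"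
      using a(2) by (simp add: F_def in_keys_iff flip: power2_eq_square)
    also have "\<dots> \<le> (\<Sum>L\<in>Poly_Mapping.keys a.
        Poly_Mapping.lookup a G * Poly_Mapping.lookup a L * of_bool (unlabel (G + L) = F))"
      using a(2) nonneg[OF supp[OF a] supp[OF a(1)]]
      by (intro member_le_sum[of G _ "\<lambda>L. Poly_Mapping.lookup a G * Poly_Mapping.lookup a L * of_bool (unlabel (G + L) = F)"])
        simp_all
    also have "\<dots> \<le> (\<Sum>H\<in>Poly_Mapping.keys a. \<Sum>L\<in>Poly_Mapping.keys a.
        Poly_Mapping.lookup a H * Poly_Mapping.lookup a L * of_bool (unlabel (H + L) = F))"
      using a(2) nonneg[OF supp[OF a(1)] supp[OF a(1)]]
      by (intro member_le_sum[of G _ "\<lambda>H. \<Sum>L\<in>Poly_Mapping.keys a.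
        Poly_Mapping.lookup a H * Poly_Mapping.lookup a L * of_bool (unlabel (H + L) = F)"] sum_nonneg)
        simp_all
    also have "\<dots> \<le> Poly_Mapping.lookup T F"
      unfolding coeff sum_list_map_remove1[OF a(1)]
      using inner set_remove1_subset[of a as] by (auto intro!: sum_list_nonneg simp: subset_iff)
    finally show False using le[of F] F by simp
  qed
  then have path: "unlabel (H + H) = path_graph k" if "H \<in> supp" "num_edges (H + H) \<le> k" for H
    using that by (auto simp: X_def)
  have "unlabel (H + L) \<noteq> Q" if HL: "H \<in> supp" "L \<in> supp" for H L
  proof
    assume eq: "unlabel (H + L) = Q"
    then have e: "num_edges (H + L) \<le> k" using Q(1) by (metis num_edges_unlabel)
    \<comment> \<open>Two numbers with sum at most \<open>2 * k\<close> cannot both exceed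
      \<open>k\<close>, so one square is the path, and absorption makes the product the path, unlike
      \<open>Q\<close>.\<close>
    then have "num_edges (H + H) \<le> k \<or> num_edges (L + L) \<le> k"
      using num_edges_square_le[of H L] by linarith
    then show False using path HL not_path[of H L] eq e Q(2) by auto
  qed
  then have "(\<Sum>G\<in>Poly_Mapping.keys a. \<Sum>H\<in>Poly_Mapping.keys a.
      Poly_Mapping.lookup a G * Poly_Mapping.lookup a H * of_bool (unlabel (G + H) = Q)) = 0"
    if "a \<in> set as" for a
    using that by (intro sum.neutral ballI) (auto simp: supp_def)
  then show ?thesis by (simp only: coeff sum_list_0 cong: map_cong)
qed

section \<open>The coefficient of the disjoint union of \<open>k\<close> edges\<close>

theorem corollary1p4:
  fixes lam :: real and k :: nat
  assumes "odd k" and "k \<ge> 3"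
  shows "\<not> (\<exists>g. sos g \<and> sos ((lam *\<^sub>R gc (path_graph k) - gc edge_graph ^ k) * (1 + g)))"
proof
  assume "\<exists>g. sos g \<and> sos ((lam *\<^sub>R gc (path_graph k) - gc edge_graph ^ k) * (1 + g))"
  then obtain g where g: "sos g" and sos: "sos ((lam *\<^sub>R gc (path_graph k) - gc edge_graph ^ k) * (1 + g))"
    by blast
  obtain Q where Q: "gc edge_graph ^ k = gc Q" "unlabeled Q" "num_edges Q = k" "num_verts Q = 2 * k"
    using gc_edge_power by blast
  have P: "unlabeled (path_graph k)" "num_edges (path_graph k) = k" "num_verts (path_graph k) = Suc k"
    using path_graph_invariants assms(2) by auto
  have ne: "Q \<noteq> path_graph k"
  proof
    assume "Q = path_graph k"
    then show False using Q(4) P(3) assms(2) by simp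
  qed
  have "1 + g \<in> unlabeled_combs"
    using g keys_add[of 1 g] unlabeled_zero by (auto simp: sos_def unlabeled_combs_def)
  note mult = lookup_single_mult_unlabeled[OF this]
  \<comment> \<open>The constant term of \<open>1 + g\<close>, which is at least 1.\<close>
  define c where "c = Poly_Mapping.lookup (1 + g) 0"
  have c: "c > 0" using sos_lookup_zero_nonneg[OF g] by (simp add: c_def lookup_add)
  have lam: "lam *\<^sub>R gc (path_graph k) = Poly_Mapping.single (path_graph k) lam"
    by (rule poly_mapping_eqI) (simp add: lookup_scaleR gc_def lookup_single when_def)
  \<comment> \<open>Up to \<open>k\<close> edges the factor \<open>1 + g\<close> acts as the
    constant \<open>c\<close>; thus only the path and \<open>Q\<close> survive, and \<open>Q\<close>
    has coefficient \<open>- c\<close>.\<close>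
  have coeff: "Poly_Mapping.lookup ((lam *\<^sub>R gc (path_graph k) - gc edge_graph ^ k) * (1 + g)) F =
      (lam * of_bool (F = path_graph k) - of_bool (F = Q)) * c" if "num_edges F \<le> k" for F
    using mult[OF P(1), of F lam] mult[OF Q(2), of F 1] P(2) Q(3) that
    unfolding lam Q(1) gc_def[of Q] left_diff_distrib lookup_minus c_def by simp
  have "Poly_Mapping.lookup ((lam *\<^sub>R gc (path_graph k) - gc edge_graph ^ k) * (1 + g)) Q = 0"
    by (rule sos_low_degree_coeff[OF assms(1) sos]) (use coeff c Q(3) ne in auto)
  then show False using coeff[of Q] c Q(3) ne by simp
qed

end
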